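(* For the online problem of packing disjoint connected spanning subhypergraphs (defined in the context), there exists a randomized online algorithm with (pure, expected) competitive ratio $O(\log^2 n)$, where $n$ is the number of vertices of the input hypergraph. The running time of the algorithm at each timestep $t$ is $O(|e_t|^2)$, where $e_t$ is the hyperedge arriving at time $t$. In particular, for input graphs (the problem of packing disjoint spanning trees with edges arriving online), the algorithm runs in constant time per timestep.
   Context: A hypergraph $G=(V,E)$ has a finite vertex set $V$ with $n=|V|$ and a multiset $E$ of nonempty subsets of $V$ (hyperedges). $G$ is connected if its bipartite incidence graph (vertices $V\cup E$, with $u\in V$ adjacent to $e\in E$ iff $u\in e$) is connected. A sub-multiset $F\subseteq E$ is a connected spanning subhypergraph if $\bigcup_{e\in F}e=V$ and $(V,F)$ is connected. Let $\texttt{opt}(G)$ be the maximum number of pairwise disjoint connected spanning subhypergraphs of a connected hypergraph $G$. Online model: $V$ is known in advance; the hyperedges arrive one at a time in an arbitrary order $e_1,\dots,e_m$, and the algorithm must irrevocably assign a color (positive integer) to $e_t$ upon its arrival. A color is a connected spanning color if the hyperedges of that color form a connected spanning subhypergraph. Let $\texttt{Alg}(G)$ be the number of connected spanning colors. A randomized online algorithm has expected competitive ratio $\alpha$ if $\mathbb{E}[\texttt{Alg}(G)]\ge\texttt{opt}(G)/\alpha$ for every connected hypergraph $G$ and every arrival order. Logarithms are base 2. *)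

theory Defs
  imports "HOL-Probability.Probability" "HOL-Library.Landau_Symbols"
    "HOL-Library.Log_Nat" "HOL-Library.Discrete_Functions"
begin

section \<open>Hypergraphs\<close>

text \<open>The vertex set is required to be nonempty: over an empty vertex set the empty
  subhypergraph would be connected and spanning, and the optimum would be unbounded.\<close>

definition hypergraph :: "'v set \<Rightarrow> 'v set multiset \<Rightarrow> bool" where
  "hypergraph V E \<longleftrightarrow> finite V \<and> V \<noteq> {} \<and> (\<forall>e\<in>#E. e \<noteq> {} \<and> e \<subseteq> V)"

text \<open>In the incidence graph the copies of a hyperedge \<open>e\<close> of multiplicity \<open>k\<close> are the distinct
  nodes \<open>Inr (e, 0), \<dots>, Inr (e, k - 1)\<close>.\<close>

definition incidence_nodes :: "'v set \<Rightarrow> 'v set multiset \<Rightarrow> ('v + 'v set \<times> nat) set" where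
  "incidence_nodes V E = Inl ` V \<union> Inr ` {(e, i). i < count E e}"

definition incidence_adj ::
    "'v set \<Rightarrow> 'v set multiset \<Rightarrow> (('v + 'v set \<times> nat) \<times> ('v + 'v set \<times> nat)) set" where
  "incidence_adj V E =
     {(x, y). \<exists>u e i. u \<in> V \<and> i < count E e \<and> u \<in> e \<and>
        (x = Inl u \<and> y = Inr (e, i) \<or> x = Inr (e, i) \<and> y = Inl u)}"

definition connected_hypergraph :: "'v set \<Rightarrow> 'v set multiset \<Rightarrow> bool" where
  "connected_hypergraph V E \<longleftrightarrow>
     (\<forall>x\<in>incidence_nodes V E. \<forall>y\<in>incidence_nodes V E. (x, y) \<in> (incidence_adj V E)\<^sup>*)"

definition connected_spanning :: "'v set \<Rightarrow> 'v set multiset \<Rightarrow> bool" where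
  "connected_spanning V F \<longleftrightarrow> \<Union> (set_mset F) = V \<and> connected_hypergraph V F"

text \<open>Sub-multisets are disjoint, as sets of copies of hyperedges, iff their multiset sum is still
  contained in \<open>E\<close>.\<close>

definition opt :: "'v set \<Rightarrow> 'v set multiset \<Rightarrow> nat" where
  "opt V E = Max {k. \<exists>Fs. length Fs = k \<and> (\<forall>F\<in>set Fs. connected_spanning V F) \<and> sum_list Fs \<subseteq># E}"

definition color_class :: "'v set list \<Rightarrow> nat list \<Rightarrow> nat \<Rightarrow> 'v set multiset" where
  "color_class es cs c = mset (map fst (filter (\<lambda>(e, c'). c' = c) (zip es cs)))"

definition num_connected_spanning_colors :: "'v set \<Rightarrow> 'v set list \<Rightarrow> nat list \<Rightarrow> nat" where
  "num_connected_spanning_colors V es cs = card {c. connected_spanning V (color_class es cs c)}"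


section \<open>Randomized word RAM\<close>

text \<open>
  Running times refer to a unit-cost word RAM. A program has a random-access memory of words
  (initially all \<open>0\<close>) and read-only access to the number of vertices (\<open>NumVerts\<close>) and to the
  hyperedge that has just arrived (\<open>EdgeSize\<close> and \<open>EdgeVert\<close>, the latter indexed from \<open>0\<close>).
  All results are truncated to the word size. \<open>Msb a\<close> is the position \<open>\<lfloor>log\<^sub>2 a\<rfloor>\<close> of the
  most significant bit; \<open>Sub\<close> is cut off at \<open>0\<close>; \<open>Less\<close> and \<open>Equal\<close> yield \<open>0\<close> or \<open>1\<close>.
\<close>

datatype binop = Add | Sub | Mult | Quot | Rem | Shl | Shr | Less | Equal

datatype expr =
    Const nat
  | NumVerts
  | EdgeSize
  | EdgeVert expr
  | Load expr
  | Msb expr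
  | Bin binop expr expr

datatype com =
    Skip
  | Store expr expr      \<comment> \<open>address, value\<close>
  | Sample expr expr     \<comment> \<open>address, largest value: stores a uniform element of \<open>{0..b}\<close>\<close>
  | Seq com com
  | If expr com com
  | While expr com

type_synonym memory = "nat \<Rightarrow> nat"

fun eval_binop :: "binop \<Rightarrow> nat \<Rightarrow> nat \<Rightarrow> nat" where
  "eval_binop Add a b = a + b"
| "eval_binop Sub a b = a - b"
| "eval_binop Mult a b = a * b"
| "eval_binop Quot a b = a div b"
| "eval_binop Rem a b = a mod b"
| "eval_binop Shl a b = push_bit b a"
| "eval_binop Shr a b = drop_bit b a"
| "eval_binop Less a b = of_bool (a < b)"
| "eval_binop Equal a b = of_bool (a = b)"

text \<open>Parameters: word size \<open>w\<close>, number of vertices \<open>n\<close>, and the list \<open>r\<close> of the vertices of the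
  arriving hyperedge.\<close>

primrec eval_expr :: "nat \<Rightarrow> nat \<Rightarrow> nat list \<Rightarrow> expr \<Rightarrow> memory \<Rightarrow> nat" where
  "eval_expr w n r (Const a) m = take_bit w a"
| "eval_expr w n r NumVerts m = take_bit w n"
| "eval_expr w n r EdgeSize m = take_bit w (length r)"
| "eval_expr w n r (EdgeVert x) m =
     (let i = eval_expr w n r x m in if i < length r then take_bit w (r ! i) else 0)"
| "eval_expr w n r (Load x) m = take_bit w (m (eval_expr w n r x m))"
| "eval_expr w n r (Msb x) m = take_bit w (floor_log (eval_expr w n r x m))"
| "eval_expr w n r (Bin f x y) m =
     take_bit w (eval_binop f (eval_expr w n r x m) (eval_expr w n r y m))"

primrec expr_cost :: "expr \<Rightarrow> nat" where
  "expr_cost (Const a) = 1"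
| "expr_cost NumVerts = 1"
| "expr_cost EdgeSize = 1"
| "expr_cost (EdgeVert x) = 1 + expr_cost x"
| "expr_cost (Load x) = 1 + expr_cost x"
| "expr_cost (Msb x) = 1 + expr_cost x"
| "expr_cost (Bin f x y) = 1 + expr_cost x + expr_cost y"

partial_function (spmf) loop :: "('s \<Rightarrow> bool) \<Rightarrow> ('s \<Rightarrow> 's spmf) \<Rightarrow> 's \<Rightarrow> 's spmf" where
  "loop b f s = (if b s then bind_spmf (f s) (loop b f) else return_spmf s)"

text \<open>The state is the memory together with the number of unit-cost operations performed so far.
  Nontermination shows up as missing probability mass.\<close>

primrec exec :: "nat \<Rightarrow> nat \<Rightarrow> nat list \<Rightarrow> com \<Rightarrow> memory \<times> nat \<Rightarrow> (memory \<times> nat) spmf" where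
  "exec w n r Skip = (\<lambda>(m, s). return_spmf (m, s + 1))"
| "exec w n r (Store x y) = (\<lambda>(m, s).
     return_spmf (m(eval_expr w n r x m := eval_expr w n r y m), s + 1 + expr_cost x + expr_cost y))"
| "exec w n r (Sample x y) = (\<lambda>(m, s).
     map_spmf (\<lambda>v. (m(eval_expr w n r x m := v), s + 1 + expr_cost x + expr_cost y))
       (spmf_of_set {0..eval_expr w n r y m}))"
| "exec w n r (Seq c d) = (\<lambda>\<sigma>. bind_spmf (exec w n r c \<sigma>) (exec w n r d))"
| "exec w n r (If x c d) = (\<lambda>(m, s).
     if eval_expr w n r x m \<noteq> 0
     then exec w n r c (m, s + 1 + expr_cost x)
     else exec w n r d (m, s + 1 + expr_cost x))"
| "exec w n r (While x c) = (\<lambda>\<sigma>.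
     map_spmf (\<lambda>(m, s). (m, s + 1 + expr_cost x))
       (loop (\<lambda>(m, s). eval_expr w n r x m \<noteq> 0)
             (\<lambda>(m, s). exec w n r c (m, s + 1 + expr_cost x)) \<sigma>))"


section \<open>Online algorithms\<close>

text \<open>An online algorithm is a single program, the same for all \<open>n\<close>, that is executed once per
  arriving hyperedge and keeps its memory between arrivals, together with a constant \<open>k\<close> fixing the
  word size at timestep \<open>t\<close> to \<open>k * \<lceil>log\<^sub>2 (n + t)\<rceil>\<close> bits, i.e. to \<open>\<Theta>(log (n + t))\<close>. The color
  assigned at a timestep is the final content of memory cell \<open>0\<close>.\<close>

type_synonym online_algorithm = "com \<times> nat"

definition word_size :: "nat \<Rightarrow> nat \<Rightarrow> nat \<Rightarrow> nat" where
  "word_size k n t = k * ceillog2 (n + t)"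

text \<open>Joint distribution of the sequence of pairs (color, running time of the timestep), for a run
  whose next timestep is \<open>t\<close>, started in memory \<open>m\<close>.\<close>

primrec run_from ::
    "online_algorithm \<Rightarrow> nat \<Rightarrow> nat list list \<Rightarrow> nat \<Rightarrow> memory \<Rightarrow> (nat \<times> nat) list spmf" where
  "run_from A n [] = (\<lambda>t m. return_spmf [])"
| "run_from A n (r # rs) = (\<lambda>t m.
     bind_spmf (exec (word_size (snd A) n t) n r (fst A) (m, 0)) (\<lambda>(m', s).
       map_spmf (\<lambda>out. (m' 0, s) # out) (run_from A n rs (t + 1) m')))"

definition run :: "online_algorithm \<Rightarrow> nat \<Rightarrow> nat list list \<Rightarrow> (nat \<times> nat) list spmf" where
  "run A n rs = run_from A n rs 1 (\<lambda>_. 0)"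

text \<open>The vertices are named \<open>0, \<dots>, n - 1\<close>. A hyperedge is handed to the algorithm as a list of its
  vertices, in arbitrary order.\<close>

definition arrival_sequence :: "nat \<Rightarrow> nat set list \<Rightarrow> nat list list \<Rightarrow> bool" where
  "arrival_sequence n es rs \<longleftrightarrow>
     hypergraph {..<n} (mset es) \<and> list_all2 (\<lambda>e r. distinct r \<and> set r = e) es rs"

text \<open>On every input the algorithm terminates with probability one and assigns positive colors.\<close>

definition valid_online_algorithm :: "online_algorithm \<Rightarrow> bool" where
  "valid_online_algorithm A \<longleftrightarrow>
     (\<forall>n es rs. arrival_sequence n es rs \<longrightarrow>
        lossless_spmf (run A n rs) \<and>
        (\<forall>out\<in>set_spmf (run A n rs). \<forall>(c, s)\<in>set out. c > 0))"

text \<open>The competitive ratio is a function of the number of vertices.\<close>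

definition expected_competitive_ratio :: "online_algorithm \<Rightarrow> (nat \<Rightarrow> real) \<Rightarrow> bool" where
  "expected_competitive_ratio A \<alpha> \<longleftrightarrow>
     (\<forall>n es rs. arrival_sequence n es rs \<and> connected_hypergraph {..<n} (mset es) \<longrightarrow>
        (\<integral>out. real (num_connected_spanning_colors {..<n} es (map fst out)) \<partial>measure_spmf (run A n rs))
          \<ge> real (opt {..<n} (mset es)) / \<alpha> n)"

text \<open>On inputs all of whose hyperedges satisfy \<open>P\<close>, the timestep in which \<open>e\<close> arrives takes at most
  \<open>f e\<close> operations, for every outcome of the random choices.\<close>

definition timestep_cost_le ::
    "online_algorithm \<Rightarrow> (nat set \<Rightarrow> bool) \<Rightarrow> (nat set \<Rightarrow> nat) \<Rightarrow> bool" where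
  "timestep_cost_le A P f \<longleftrightarrow>
     (\<forall>n es rs. arrival_sequence n es rs \<and> (\<forall>e\<in>set es. P e) \<longrightarrow>
        (\<forall>out\<in>set_spmf (run A n rs). \<forall>t<length es. snd (out ! t) \<le> f (es ! t)))"

end

theory Submission
  imports Defs
begin

text \<open>
  Let \<open>k\<close> be the optimum, so that every cut is crossed by at least \<open>k\<close> hyperedges. For each ordered
  pair \<open>(u, v)\<close>, count the hyperedges containing both, and let \<open>\<eta>\<close> be the minimum of these counters
  over the pairs of the arriving hyperedge. At least \<open>k / 2\<close> of the hyperedges crossing any cut have
  \<open>\<eta>\<close> between \<open>k / (2 n\<^sup>2)\<close> and \<open>k\<close>, so for them a uniformly random guess of \<open>k / \<eta>\<close> among \<open>O(log n)\<close>
  powers of two is right with probability \<open>\<Omega>(1 / log n)\<close>. Coloring a hyperedge uniformly from about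
  \<open>k / log\<^sup>2 n\<close> colors, for the guessed \<open>k\<close>, gives each such hyperedge every one of these colors with
  probability \<open>\<Omega>(log n / k)\<close>. Scale these probabilities by \<open>s \<in> [0, 1]\<close>: by Russo's formula the
  expected number of components of a color class, counted as \<open>0\<close> once the class is connected and
  spanning, decays like \<open>n exp (- c s log n)\<close>, so that each color succeeds with probability at least
  one half. A single fair coin, flipped at the start, gives all hyperedges color \<open>1\<close> with
  probability one half, which covers optima of order \<open>log\<^sup>2 n\<close>.
\<close>

subsection \<open>Hypergraphs and components\<close>

text \<open>For \<open>X = V\<close> every hyperedge crosses, since a spanning subhypergraph is nonempty even if \<open>V\<close> is a
  singleton and there is no proper cut.\<close>

definition crosses :: "'v set \<Rightarrow> 'v set \<Rightarrow> 'v set \<Rightarrow> bool" where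
  "crosses V X e \<longleftrightarrow> e \<inter> X \<noteq> {} \<and> (e \<subseteq> X \<longrightarrow> X = V)"

text \<open>Joining the vertices of each hyperedge and closing gives the components without
  incidence nodes. Vertices in no hyperedge become singleton classes.\<close>

definition vertex_rel :: "'v set \<Rightarrow> 'v set multiset \<Rightarrow> ('v \<times> 'v) set" where
  "vertex_rel V F = (\<Union>e\<in>set_mset F. e \<times> e)\<^sup>* \<inter> V \<times> V"

definition comps :: "'v set \<Rightarrow> 'v set multiset \<Rightarrow> 'v set set" where
  "comps V F = V // vertex_rel V F"

lemma equiv_vertex_rel: "equiv V (vertex_rel V F)"
proof -
  have "sym ((\<Union>e\<in>set_mset F. e \<times> e)\<^sup>*)"
    by (intro sym_rtrancl) (auto simp: sym_def)
  thus ?thesis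
    by (intro equivI) (auto simp: vertex_rel_def refl_on_def sym_def trans_def intro: rtrancl_trans)
qed

text \<open>A path of vertices lifts to the incidence graph through the first copy
  \<open>Inr (e, 0)\<close> of each hyperedge used, and every hyperedge node is adjacent to some
  vertex. \<open>F\<close> must be nonempty: on a single vertex the relation is total even without
  hyperedges, but then nothing covers the vertex.\<close>

lemma connected_spanningI:
  assumes "hypergraph V F" "F \<noteq> {#}" "\<And>x y. x \<in> V \<Longrightarrow> y \<in> V \<Longrightarrow> (x, y) \<in> vertex_rel V F"
  shows "connected_spanning V F"
proof -
  have edges: "e \<noteq> {}" "e \<subseteq> V" if "e \<in># F" for e
    using assms(1) that by (auto simp: hypergraph_def)
  have "x \<in> \<Union> (set_mset F)" if "x \<in> V" for x
  proof (rule ccontr)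
    assume x: "x \<notin> \<Union> (set_mset F)"
    obtain e where "e \<in># F" using assms(2) by auto
    then obtain y where y: "y \<in> e" "y \<in> V" using edges[of e] by blast
    have "(x, y) \<in> (\<Union>e\<in>set_mset F. e \<times> e)\<^sup>*"
      using assms(3)[OF that y(2)] by (simp add: vertex_rel_def)
    hence "x = y" using x by (auto elim: converse_rtranclE)
    thus False using x y \<open>e \<in># F\<close> by blast
  qed
  hence cover: "\<Union> (set_mset F) = V" using edges by blast
  let ?A = "(incidence_adj V F)\<^sup>*"
  have sym: "sym ?A" by (intro sym_rtrancl) (auto simp: sym_def incidence_adj_def)
  have path: "(Inl x, Inl y) \<in> ?A" if "(x, y) \<in> (\<Union>e\<in>set_mset F. e \<times> e)\<^sup>*" for x y
    using that
  proof induction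
    case (step y z)
    then obtain e where e: "e \<in># F" "y \<in> e" "z \<in> e" by auto
    hence "(Inl y, Inr (e, 0)) \<in> incidence_adj V F" "(Inr (e, 0), Inl z) \<in> incidence_adj V F"
      using edges[of e] by (auto simp: incidence_adj_def)
    thus ?case using step.IH by (meson rtrancl.rtrancl_into_rtrancl)
  qed simp
  have reach: "\<exists>v\<in>V. (a, Inl v) \<in> ?A" if "a \<in> incidence_nodes V F" for a
  proof (cases a)
    case (Inl v)
    thus ?thesis using that by (auto simp: incidence_nodes_def)
  next
    case (Inr ei)
    obtain e i where "ei = (e, i)" by (cases ei)
    with Inr have ei: "a = Inr (e, i)" "i < count F e"
      using that by (auto simp: incidence_nodes_def)
    hence "e \<in># F" by (simp add: count_inI)
    then obtain v where "v \<in> e" "v \<in> V" using edges[of e] by blast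
    hence "(a, Inl v) \<in> incidence_adj V F" using ei by (auto simp: incidence_adj_def)
    thus ?thesis using \<open>v \<in> V\<close> by blast
  qed
  have "(a, b) \<in> ?A" if ab: "a \<in> incidence_nodes V F" "b \<in> incidence_nodes V F" for a b
  proof -
    obtain u v where "u \<in> V" "v \<in> V" "(a, Inl u) \<in> ?A" "(b, Inl v) \<in> ?A"
      using reach ab by blast
    moreover have "(Inl u, Inl v) \<in> ?A"
      using assms(3)[OF \<open>u \<in> V\<close> \<open>v \<in> V\<close>] path by (auto simp: vertex_rel_def)
    ultimately show ?thesis using sym by (meson rtrancl_trans symD)
  qed
  thus ?thesis using cover by (simp add: connected_spanning_def connected_hypergraph_def)
qed

lemma connected_spanning_crosses:
  assumes "connected_spanning V F" "X \<subseteq> V" "X \<noteq> {}"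
  shows "\<exists>e\<in>#F. crosses V X e"
proof (rule ccontr)
  assume none: "\<not> (\<exists>e\<in>#F. crosses V X e)"
  have cover: "\<Union> (set_mset F) = V" using assms(1) by (simp add: connected_spanning_def)
  obtain x where x: "x \<in> X" using assms(3) by auto
  then obtain e where "e \<in># F" "x \<in> e" using cover assms(2) by blast
  hence "X \<noteq> V" using none x by (auto simp: crosses_def)
  then obtain y where y: "y \<in> V" "y \<notin> X" using assms(2) by auto
  have "(Inl x, Inl y) \<in> (incidence_adj V F)\<^sup>*"
  proof -
    have "Inl x \<in> incidence_nodes V F" "Inl y \<in> incidence_nodes V F"
      using assms(2) x y by (auto simp: incidence_nodes_def)
    thus ?thesis using assms(1) unfolding connected_spanning_def connected_hypergraph_def by blast
  qed
  \<comment> \<open>If nothing crosses \<open>X\<close>, incidence paths from \<open>x\<close> stay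
    on vertices of \<open>X\<close> and hyperedges contained in \<open>X\<close>, so they never
    reach \<open>y\<close>.\<close>
  moreover have "case b of Inl v \<Rightarrow> v \<in> X | Inr (e, i) \<Rightarrow> e \<subseteq> X"
    if "(Inl x, b) \<in> (incidence_adj V F)\<^sup>*" for b
    using that
  proof induction
    case base
    thus ?case using x by simp
  next
    case (step b c)
    then obtain u e i where *: "i < count F e" "u \<in> e"
      "b = Inl u \<and> c = Inr (e, i) \<or> b = Inr (e, i) \<and> c = Inl u"
      by (auto simp: incidence_adj_def)
    hence "e \<in># F" by (simp add: count_inI)
    hence "\<not> crosses V X e" using none by blast
    thus ?case using * step.IH by (auto simp: crosses_def)
  qed
  ultimately show False using y by fastforce
qed

lemma connected_spanning_nonempty: "connected_spanning V F \<Longrightarrow> V \<noteq> {} \<Longrightarrow> F \<noteq> {#}"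
  by (auto simp: connected_spanning_def)

text \<open>Were \<open>x\<close> and \<open>y\<close> in different components of \<open>G\<close>,
  the component of \<open>x\<close> would be a cut. A hyperedge of \<open>F\<close> crosses it, and
  this hyperedge also belongs to \<open>G\<close>.\<close>

lemma connected_spanning_mono:
  assumes "connected_spanning V F" "F \<subseteq># G" "hypergraph V G"
  shows "connected_spanning V G"
proof (rule connected_spanningI)
  show "hypergraph V G" by fact
  have V: "V \<noteq> {}" using assms(3) by (simp add: hypergraph_def)
  show "G \<noteq> {#}" using connected_spanning_nonempty[OF assms(1) V] assms(2) by auto
  fix x y assume xy: "x \<in> V" "y \<in> V"
  show "(x, y) \<in> vertex_rel V G"
  proof (rule ccontr)
    assume no: "(x, y) \<notin> vertex_rel V G"
    define X where "X = vertex_rel V G `` {x}"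
    have eq: "equiv V (vertex_rel V G)" by (rule equiv_vertex_rel)
    have "x \<in> X" "X \<subseteq> V" "y \<notin> X"
      using xy no eq by (auto simp: X_def equiv_def refl_on_def vertex_rel_def)
    then obtain e where e: "e \<in># F" "crosses V X e"
      using connected_spanning_crosses[OF assms(1)] by blast
    have eG: "e \<in># G" using assms(2) e(1) by (rule mset_subset_eqD)
    hence "e \<subseteq> V" using assms(3) by (auto simp: hypergraph_def)
    obtain u v where uv: "u \<in> e" "u \<in> X" "v \<in> e" "v \<notin> X"
      using e(2) \<open>y \<notin> X\<close> xy by (auto simp: crosses_def)
    have "(u, v) \<in> vertex_rel V G"
      using uv eG \<open>e \<subseteq> V\<close> by (auto simp: vertex_rel_def intro!: r_into_rtrancl)
    thus False using uv eq by (auto simp: X_def equiv_def dest: transD)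
  qed
qed

lemma comps_eq_oneI:
  assumes "hypergraph V F" "F \<noteq> {#}" "card (comps V F) = 1"
  shows "connected_spanning V F"
proof (rule connected_spanningI)
  fix x y assume xy: "x \<in> V" "y \<in> V"
  let ?R = "vertex_rel V F"
  have "?R `` {x} \<in> comps V F" "?R `` {y} \<in> comps V F"
    using xy by (auto simp: comps_def quotientI)
  hence "?R `` {x} = ?R `` {y}" using assms(3) by (metis card_1_singletonE singletonD)
  thus "(x, y) \<in> ?R" using xy equiv_vertex_rel[of V F]
    by (metis eq_equiv_class_iff)
qed (use assms in auto)

lemma finite_comps: "finite V \<Longrightarrow> finite (comps V F)"
  unfolding comps_def by (rule finite_quotient) (auto simp: vertex_rel_def)

lemma card_comps_le:
  assumes "finite V" shows "card (comps V F) \<le> card V"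
proof -
  have "comps V F = (\<lambda>x. vertex_rel V F `` {x}) ` V"
    by (auto simp: comps_def quotient_def)
  thus ?thesis using assms by (simp add: card_image_le)
qed

lemma card_comps_pos:
  assumes "finite V" "V \<noteq> {}" shows "card (comps V F) \<ge> 1"
proof -
  have "comps V F \<noteq> {}" using assms(2) by (auto simp: comps_def quotient_def)
  thus ?thesis using finite_comps[OF assms(1), of F] by (simp add: Suc_le_eq card_gt_0_iff)
qed

text \<open>Adding the hyperedge \<open>e\<close> merges all components that it meets into one.\<close>

lemma card_comps_add:
  assumes "finite V" "F \<subseteq># G" "e \<in># G" "e \<subseteq> V" "e \<noteq> {}"
  shows "card (comps V G) + card {X \<in> comps V F. X \<inter> e \<noteq> {}} \<le> card (comps V F) + 1"
proof -
  let ?R = "vertex_rel V F" and ?S = "vertex_rel V G"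
  let ?T = "{X \<in> comps V F. X \<inter> e \<noteq> {}}"
  obtain x where x: "x \<in> e" using assms by auto
  have eqR: "equiv V ?R" and eqS: "equiv V ?S" by (rule equiv_vertex_rel)+
  have sub: "?R \<subseteq> ?S"
  proof -
    have "set_mset F \<subseteq> set_mset G" using assms(2) by (rule set_mset_mono)
    hence "(\<Union>e\<in>set_mset F. e \<times> e)\<^sup>* \<subseteq> (\<Union>e\<in>set_mset G. e \<times> e)\<^sup>*" by (intro rtrancl_mono) auto
    thus ?thesis by (auto simp: vertex_rel_def)
  qed
  have eS: "(u, v) \<in> ?S" if "u \<in> e" "v \<in> e" for u v
    using that assms(3,4) by (auto simp: vertex_rel_def intro!: r_into_rtrancl)
  \<comment> \<open>Every component of \<open>G\<close> is the \<open>?S\<close>-closure of a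
    component of \<open>F\<close>, and those meeting \<open>e\<close> all have the same closure, the
    class of \<open>x\<close>.\<close>
  have "comps V G \<subseteq> insert (?S `` {x}) ((\<lambda>X. ?S `` X) ` (comps V F - ?T))"
  proof
    fix Y assume "Y \<in> comps V G"
    then obtain y where y: "y \<in> V" "Y = ?S `` {y}" by (auto simp: comps_def quotient_def)
    define X where "X = ?R `` {y}"
    have X: "X \<in> comps V F" using y by (auto simp: X_def comps_def quotientI)
    have yX: "y \<in> X" using y eqR by (auto simp: X_def equiv_def refl_on_def)
    have YX: "Y = ?S `` X"
      using y(2) yX sub eqS unfolding X_def by (auto simp: equiv_def dest: transD)
    show "Y \<in> insert (?S `` {x}) ((\<lambda>X. ?S `` X) ` (comps V F - ?T))"
    proof (cases "X \<inter> e = {}")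
      case True
      thus ?thesis using X YX by auto
    next
      case False
      then obtain z where "z \<in> X" "z \<in> e" by auto
      hence "(y, z) \<in> ?S" "(z, x) \<in> ?S" using sub eS x by (auto simp: X_def)
      hence "(y, x) \<in> ?S" using eqS by (auto simp: equiv_def dest: transD)
      hence "Y = ?S `` {x}" using y(2) eqS by (simp add: equiv_class_eq)
      thus ?thesis by simp
    qed
  qed
  moreover have fin: "finite (comps V F)" using assms(1) by (rule finite_comps)
  ultimately have "card (comps V G) \<le> card (insert (?S `` {x}) ((\<lambda>X. ?S `` X) ` (comps V F - ?T)))"
    by (intro card_mono) auto
  also have "\<dots> \<le> Suc (card ((\<lambda>X. ?S `` X) ` (comps V F - ?T)))" by (rule card_insert_le_m1) auto
  also have "\<dots> \<le> Suc (card (comps V F - ?T))" using fin by (simp add: card_image_le)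
  also have "card (comps V F - ?T) = card (comps V F) - card ?T"
    using fin by (intro card_Diff_subset) auto
  finally show ?thesis
    using card_mono[OF fin, of ?T] by auto
qed

text \<open>Apply the merging bound to any hyperedge of \<open>G\<close>: it meets at least one
  component of \<open>F\<close>, which cancels the \<open>+ 1\<close>.\<close>

lemma card_comps_mono:
  assumes "finite V" "hypergraph V G" "F \<subseteq># G"
  shows "card (comps V G) \<le> card (comps V F)"
proof (cases "G = {#}")
  case False
  then obtain e where e: "e \<in># G" by auto
  hence eV: "e \<subseteq> V" "e \<noteq> {}" using assms(2) by (auto simp: hypergraph_def)
  then obtain x where x: "x \<in> e" "x \<in> V" by auto
  have "vertex_rel V F `` {x} \<in> {X \<in> comps V F. X \<inter> e \<noteq> {}}"
    using x equiv_vertex_rel[of V F] by (auto simp: comps_def quotientI equiv_def refl_on_def)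
  hence "card {X \<in> comps V F. X \<inter> e \<noteq> {}} \<ge> 1"
    using finite_comps[OF assms(1), of F] by (auto simp: Suc_le_eq card_gt_0_iff)
  thus ?thesis using card_comps_add[OF assms(1,3) e eV] by simp
qed (use assms(3) in auto)

text \<open>The value \<open>0\<close> on success makes the deficit at least \<open>1\<close>
  exactly on failure (for finite nonempty \<open>V\<close>), so its expectation bounds the failure
  probability. It also tells a single uncovered vertex, which already forms one component, from
  success.\<close>

definition deficit :: "'v set \<Rightarrow> 'v set multiset \<Rightarrow> nat" where
  "deficit V F = (if connected_spanning V F then 0 else card (comps V F))"

lemma deficit_le: "finite V \<Longrightarrow> deficit V F \<le> card V"
  using card_comps_le by (auto simp: deficit_def)

lemma deficit_mono:
  assumes "hypergraph V G" "F \<subseteq># G" shows "deficit V G \<le> deficit V F"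
  using assms card_comps_mono[of V G F] connected_spanning_mono[of V F G]
  by (auto simp: deficit_def hypergraph_def)

text \<open>A hyperedge meeting \<open>j\<close> components removes at least \<open>j - 1\<close> of
  them, and \<open>j - 1 \<ge> j / 2\<close> once \<open>j \<ge> 2\<close>. A hyperedge that crosses
  a component also leaves it, so \<open>j \<ge> 2\<close>, except when \<open>V\<close> is the only
  component; then any hyperedge completes the connection and the deficit drops from \<open>1\<close>
  to \<open>0\<close>.\<close>

lemma deficit_add:
  assumes "hypergraph V G" "F \<subseteq># G" "e \<in># G" "\<not> connected_spanning V F"
  shows "card {X \<in> comps V F. crosses V X e} + 2 * deficit V G \<le> 2 * deficit V F"
proof -
  have fin: "finite V" and V: "V \<noteq> {}" and eV: "e \<subseteq> V" "e \<noteq> {}"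
    using assms by (auto simp: hypergraph_def)
  let ?C = "{X \<in> comps V F. crosses V X e}" and ?T = "{X \<in> comps V F. X \<inter> e \<noteq> {}}"
  have finC: "finite (comps V F)" using fin by (rule finite_comps)
  have CT: "card ?C \<le> card ?T" using finC by (intro card_mono) (auto simp: crosses_def)
  have add: "card (comps V G) + card ?T \<le> card (comps V F) + 1"
    using card_comps_add[OF fin assms(2,3) eV] .
  have dF: "deficit V F = card (comps V F)" using assms(4) by (simp add: deficit_def)
  have dG: "deficit V G \<le> card (comps V G)" by (simp add: deficit_def)
  have pos: "card (comps V F) \<ge> 1" "card (comps V G) \<ge> 1"
    using card_comps_pos[OF fin V] by auto
  show ?thesis
  proof (cases "card (comps V F) = 1")
    case True
    hence "card (comps V G) = 1"
      using card_comps_mono[OF fin assms(1,2)] pos by linarith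
    moreover have "G \<noteq> {#}" using assms(3) by auto
    ultimately have "connected_spanning V G" using comps_eq_oneI[OF assms(1)] by blast
    hence "deficit V G = 0" by (simp add: deficit_def)
    moreover have "card ?C \<le> 1" using card_mono[OF finC, of ?C] True by auto
    ultimately show ?thesis using dF True by simp
  next
    case False
    show ?thesis
    proof (cases "?C = {}")
      case True
      thus ?thesis using deficit_mono[OF assms(1,2)] by (metis add_0 card.empty mult_le_mono2)
    next
      case False
      then obtain X where X: "X \<in> comps V F" "crosses V X e" by auto
      have "X \<noteq> V"
      proof
        assume "X = V"
        have "Y = V" if Y: "Y \<in> comps V F" for Y
        proof -
          note eq = equiv_vertex_rel[of V F]
          have "X = Y \<or> X \<inter> Y = {}"
            using quotient_disj[OF eq] X(1) Y unfolding comps_def by blast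
          moreover have "Y \<subseteq> V" using in_quotient_imp_subset[OF eq] Y unfolding comps_def by blast
          moreover have "Y \<noteq> {}" using in_quotient_imp_non_empty[OF eq] Y unfolding comps_def by blast
          ultimately show ?thesis using \<open>X = V\<close> by auto
        qed
        hence "comps V F \<subseteq> {V}" by blast
        hence "card (comps V F) \<le> card {V}" by (intro card_mono) auto
        thus False using \<open>card (comps V F) \<noteq> 1\<close> pos by (simp del: One_nat_def)
      qed
      then obtain v where v: "v \<in> e" "v \<notin> X" using X(2) by (auto simp: crosses_def)
      define Y where "Y = vertex_rel V F `` {v}"
      have "Y \<in> comps V F" "v \<in> Y"
        using v eV equiv_vertex_rel[of V F]
        by (auto simp: Y_def comps_def quotientI equiv_def refl_on_def)
      hence "{X, Y} \<subseteq> ?T" "X \<noteq> Y" using X v by (auto simp: crosses_def)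
      hence "card ?T \<ge> 2" using card_mono[of ?T "{X, Y}"] finC by auto
      thus ?thesis using CT add dF dG by simp
    qed
  qed
qed

subsection \<open>Independent selections\<close>

text \<open>The expectation of \<open>g\<close> over independent bits with biases \<open>ps\<close>,
  written as a recursion on reals instead of a measure: it is a polynomial in the biases and can be
  differentiated at every real scaling \<open>s\<close>.\<close>

primrec bernoulli_sum :: "real list \<Rightarrow> (bool list \<Rightarrow> real) \<Rightarrow> real" where
  "bernoulli_sum [] g = g []"
| "bernoulli_sum (p # ps) g =
     p * bernoulli_sum ps (\<lambda>b. g (True # b)) + (1 - p) * bernoulli_sum ps (\<lambda>b. g (False # b))"

lemma bernoulli_sum_mono:
  assumes "\<And>p. p \<in> set ps \<Longrightarrow> 0 \<le> p \<and> p \<le> 1"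
    and "\<And>b. length b = length ps \<Longrightarrow> g b \<le> h b"
  shows "bernoulli_sum ps g \<le> bernoulli_sum ps h"
  using assms
proof (induction ps arbitrary: g h)
  case (Cons p ps)
  have "bernoulli_sum ps (\<lambda>b. g (x # b)) \<le> bernoulli_sum ps (\<lambda>b. h (x # b))" for x
    by (rule Cons.IH) (use Cons.prems in auto)
  thus ?case using Cons.prems(1)[of p] by (auto intro!: add_mono mult_left_mono)
qed auto

lemma bernoulli_sum_add:
  "bernoulli_sum ps (\<lambda>b. g b + h b) = bernoulli_sum ps g + bernoulli_sum ps h"
  by (induction ps arbitrary: g h) (auto simp: algebra_simps)

lemma bernoulli_sum_mult: "bernoulli_sum ps (\<lambda>b. c * g b) = c * bernoulli_sum ps g"
  by (induction ps arbitrary: g) (auto simp: algebra_simps)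

lemma bernoulli_sum_diff:
  "bernoulli_sum ps (\<lambda>b. g b - h b) = bernoulli_sum ps g - bernoulli_sum ps h"
  using bernoulli_sum_add[of ps g "\<lambda>b. (-1) * h b"] by (simp only: bernoulli_sum_mult) simp

lemma bernoulli_sum_const: "bernoulli_sum ps (\<lambda>b. c) = c"
  by (induction ps) (auto simp: algebra_simps)

lemma bernoulli_sum_zero: "bernoulli_sum (map ((*) 0) ps) g = g (replicate (length ps) False)"
  by (induction ps arbitrary: g) auto

text \<open>Russo's formula along the ray \<open>s \<mapsto> (s p\<^sub>1, s p\<^sub>2, \<dots>)\<close>.\<close>

lemma bernoulli_sum_deriv:
  "((\<lambda>s. bernoulli_sum (map ((*) s) ps) g) has_real_derivative
     bernoulli_sum (map ((*) s) ps)
       (\<lambda>b. \<Sum>t<length ps. ps ! t * (g (b[t := True]) - g (b[t := False])))) (at s)"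
proof (induction ps arbitrary: g)
  case (Cons p ps)
  let ?E = "\<lambda>s. bernoulli_sum (map ((*) s) ps)"
  let ?D = "\<lambda>x. \<lambda>b. \<Sum>t<length ps. ps ! t * (g (x # b[t := True]) - g (x # b[t := False]))"
  \<comment> \<open>The summand for \<open>t = 0\<close> comes from differentiating the bias
    \<open>s * p\<close> of the first bit, the later ones from the two inductive
    derivatives.\<close>
  have "bernoulli_sum (map ((*) s) (p # ps))
       (\<lambda>b. \<Sum>t<length (p # ps). (p # ps) ! t * (g (b[t := True]) - g (b[t := False])))
    = s * p * ?E s (\<lambda>b. p * (g (True # b) - g (False # b)) + ?D True b)
      + (1 - s * p) * ?E s (\<lambda>b. p * (g (True # b) - g (False # b)) + ?D False b)"
    by (simp add: sum.lessThan_Suc_shift del: sum.lessThan_Suc)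
  also have "\<dots> = p * (?E s (\<lambda>b. g (True # b)) - ?E s (\<lambda>b. g (False # b)))
      + s * p * ?E s (?D True) + (1 - s * p) * ?E s (?D False)"
    by (simp only: bernoulli_sum_add bernoulli_sum_mult bernoulli_sum_diff) (simp add: algebra_simps)
  finally have eq: "bernoulli_sum (map ((*) s) (p # ps))
       (\<lambda>b. \<Sum>t<length (p # ps). (p # ps) ! t * (g (b[t := True]) - g (b[t := False]))) = \<dots>" .
  have product: "((\<lambda>s. s * p * A s + (1 - s * p) * B s) has_real_derivative
      p * (A s - B s) + s * p * A' + (1 - s * p) * B') (at s)"
    if "(A has_real_derivative A') (at s)" "(B has_real_derivative B') (at s)" for A B :: "real \<Rightarrow> real" and A' B'
    using that by (auto intro!: derivative_eq_intros simp: algebra_simps)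
  show ?case
    unfolding eq
    using product[OF Cons.IH[of "\<lambda>b. g (True # b)"] Cons.IH[of "\<lambda>b. g (False # b)"]] by simp
qed auto

text \<open>Along the ray, Russo's formula gives \<open>F' s \<le> - c * F s\<close>, so
  \<open>F s * exp (c * s)\<close> does not increase from \<open>s = 0\<close>, where no bit is set,
  to \<open>s = 1\<close>. The hypothesis measures the drop from \<open>b\<close> itself, which by
  antitonicity is at most the drop from \<open>b[t := False]\<close> in the formula.\<close>

lemma bernoulli_sum_decay:
  assumes ps: "\<And>p. p \<in> set ps \<Longrightarrow> 0 \<le> p \<and> p \<le> 1"
    and antimono: "\<And>b t. length b = length ps \<Longrightarrow> t < length ps \<Longrightarrow> g b \<le> g (b[t := False])"
    and drop: "\<And>b. length b = length ps \<Longrightarrow>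
      c * g b \<le> (\<Sum>t<length ps. ps ! t * (g b - g (b[t := True])))"
  shows "bernoulli_sum ps g \<le> g (replicate (length ps) False) * exp (- c)"
proof -
  define F where "F s = bernoulli_sum (map ((*) s) ps) g" for s
  define F' where "F' s = bernoulli_sum (map ((*) s) ps)
       (\<lambda>b. \<Sum>t<length ps. ps ! t * (g (b[t := True]) - g (b[t := False])))" for s
  have F: "(F has_real_derivative F' s) (at s)" for s
    unfolding F_def F'_def by (rule bernoulli_sum_deriv)
  have F'_le: "F' s \<le> - c * F s" if s: "0 \<le> s" "s \<le> 1" for s
  proof -
    have "F' s \<le> bernoulli_sum (map ((*) s) ps) (\<lambda>b. - c * g b)"
      unfolding F'_def
    proof (rule bernoulli_sum_mono)
      fix b :: "bool list" assume b: "length b = length (map ((*) s) ps)"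
      have "(\<Sum>t<length ps. ps ! t * (g (b[t := True]) - g (b[t := False])))
          \<le> (\<Sum>t<length ps. - (ps ! t * (g b - g (b[t := True]))))"
      proof (rule sum_mono)
        fix t assume "t \<in> {..<length ps}"
        hence "0 \<le> ps ! t" "g b \<le> g (b[t := False])" using ps antimono[of b t] b by auto
        hence "ps ! t * (g (b[t := True]) - g (b[t := False])) \<le> ps ! t * (g (b[t := True]) - g b)"
          by (intro mult_left_mono) auto
        thus "ps ! t * (g (b[t := True]) - g (b[t := False])) \<le> - (ps ! t * (g b - g (b[t := True])))"
          by (simp add: algebra_simps)
      qed
      also have "\<dots> \<le> - c * g b" using drop[of b] b by (simp add: sum_negf)
      finally show "(\<Sum>t<length ps. ps ! t * (g (b[t := True]) - g (b[t := False]))) \<le> - c * g b" .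
    qed (use ps s in \<open>auto intro: mult_le_one\<close>)
    thus ?thesis by (simp only: F_def bernoulli_sum_mult)
  qed
  have "F 1 * exp (c * 1) \<le> F 0 * exp (c * 0)"
  proof (rule DERIV_nonpos_imp_nonincreasing[where f = "\<lambda>s. F s * exp (c * s)"])
    fix s :: real assume s: "0 \<le> s" "s \<le> 1"
    have "((\<lambda>s. F s * exp (c * s)) has_real_derivative (F' s + c * F s) * exp (c * s)) (at s)"
      using F[of s] by (auto intro!: derivative_eq_intros simp: algebra_simps)
    moreover have "(F' s + c * F s) * exp (c * s) \<le> 0"
      using F'_le[OF s] by (intro mult_nonpos_nonneg) auto
    ultimately show "\<exists>y. ((\<lambda>s. F s * exp (c * s)) has_real_derivative y) (at s) \<and> y \<le> 0" by blast
  qed simp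
  hence "F 1 \<le> F 0 * exp (- c)" by (simp add: exp_minus field_simps)
  moreover have "F 1 = bernoulli_sum ps g"
    unfolding F_def by (rule arg_cong2[of _ _ _ _ bernoulli_sum]) (auto intro: map_idI)
  moreover have "F 0 = g (replicate (length ps) False)"
    using bernoulli_sum_zero by (simp add: F_def)
  ultimately show ?thesis by simp
qed

primrec indep_pmf :: "'a pmf list \<Rightarrow> 'a list pmf" where
  "indep_pmf [] = return_pmf []"
| "indep_pmf (D # Ds) = bind_pmf D (\<lambda>c. map_pmf (Cons c) (indep_pmf Ds))"

lemma set_indep_pmf: "cs \<in> set_pmf (indep_pmf Ds) \<longleftrightarrow> list_all2 (\<lambda>c D. c \<in> set_pmf D) cs Ds"
  by (induction Ds arbitrary: cs) (auto simp: list_all2_Cons2)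

lemma finite_set_indep_pmf:
  "(\<And>D. D \<in> set Ds \<Longrightarrow> finite (set_pmf D)) \<Longrightarrow> finite (set_pmf (indep_pmf Ds))"
  by (induction Ds) auto

text \<open>For a fixed color \<open>c\<close> only the events that an entry equals \<open>c\<close>
  matter, and these are independent bits of bias \<open>pmf D c\<close>.\<close>

lemma expectation_indep_pmf:
  assumes "\<And>D. D \<in> set Ds \<Longrightarrow> finite (set_pmf D)"
  shows "(\<integral>cs. g (map (\<lambda>c'. c' = c) cs) \<partial>indep_pmf Ds) = bernoulli_sum (map (\<lambda>D. pmf D c) Ds) g"
  using assms
proof (induction Ds arbitrary: g)
  case (Cons D Ds)
  define H where "H x = bernoulli_sum (map (\<lambda>D. pmf D c) Ds) (\<lambda>b. g (x # b))" for x
  have fin: "finite (set_pmf D)" "finite (set_pmf (indep_pmf Ds))"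
    using Cons.prems by (auto intro: finite_set_indep_pmf)
  have "(\<integral>cs. g (map (\<lambda>c'. c' = c) cs) \<partial>indep_pmf (D # Ds))
      = (\<Sum>a\<in>set_pmf D. pmf D a * (\<integral>cs. g ((a = c) # map (\<lambda>c'. c' = c) cs) \<partial>indep_pmf Ds))"
    using fin by (simp add: pmf_expectation_bind[of "set_pmf D"])
  also have "\<dots> = (\<Sum>a\<in>set_pmf D. pmf D a * H (a = c))"
    unfolding H_def by (intro sum.cong refl arg_cong2[of _ _ _ _ "(*)"] Cons.IH) (use Cons.prems in auto)
  also have "\<dots> = (\<Sum>a\<in>set_pmf D. pmf D a * H False + (if a = c then pmf D c * (H True - H False) else 0))"
    by (intro sum.cong) (auto simp: algebra_simps)
  also have "\<dots> = H False + pmf D c * (H True - H False)"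
    using fin by (simp add: sum.distrib sum_pmf_eq_1 set_pmf_iff flip: sum_distrib_right)
  finally show ?case by (simp add: H_def algebra_simps)
qed auto

subsection \<open>Pair counters\<close>

text \<open>The indices satisfying \<open>P\<close> have ranks \<open>1, 2, ...\<close> in
  increasing order, so those of rank at most \<open>k\<close> are the first
  \<open>k\<close>.\<close>

lemma card_first:
  fixes P :: "nat \<Rightarrow> bool"
  shows "card {t. t < m \<and> P t \<and> card {s. s \<le> t \<and> P s} \<le> k} = min k (card {t. t < m \<and> P t})"
proof (induction m)
  case (Suc m)
  let ?Q = "\<lambda>t. P t \<and> card {s. s \<le> t \<and> P s} \<le> k"
  have split: "{t. t < Suc m \<and> R t} = (if R m then insert m {t. t < m \<and> R t} else {t. t < m \<and> R t})"
    for R :: "nat \<Rightarrow> bool" by (auto simp: less_Suc_eq)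
  have le: "{s. s \<le> m \<and> P s} = {t. t < Suc m \<and> P t}" by auto
  show ?case
    unfolding split[of ?Q] split[of P] unfolding le split[of P]
    using Suc.IH by auto
qed simp

definition pair_count :: "'v set list \<Rightarrow> 'v \<Rightarrow> 'v \<Rightarrow> nat" where
  "pair_count es u v = length (filter (\<lambda>e. u \<in> e \<and> v \<in> e) es)"

text \<open>This is \<eta>. The argument is the prefix that ends with the arriving hyperedge, so
  that hyperedge is itself counted; the pairs \<open>(u, u)\<close> are included, so singleton
  hyperedges have a minimum too.\<close>

definition min_pair_count :: "'v set list \<Rightarrow> nat" where
  "min_pair_count es = Min ((\<lambda>(u, v). pair_count es u v) ` (last es \<times> last es))"

lemma pair_count_take:
  assumes "t < length es"
  shows "pair_count (take (Suc t) es) u v = card {s. s \<le> t \<and> u \<in> es ! s \<and> v \<in> es ! s}"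
  unfolding pair_count_def length_filter_conv_card
  using assms by (intro arg_cong[of _ _ card]) auto

lemma card_pair_count_le:
  "card {t. t < length es \<and> u \<in> es ! t \<and> v \<in> es ! t \<and> pair_count (take (Suc t) es) u v \<le> k}
     = min k (card {t. t < length es \<and> u \<in> es ! t \<and> v \<in> es ! t})"
proof -
  have "{t. t < length es \<and> u \<in> es ! t \<and> v \<in> es ! t \<and> pair_count (take (Suc t) es) u v \<le> k}
      = {t. t < length es \<and> (u \<in> es ! t \<and> v \<in> es ! t) \<and> card {s. s \<le> t \<and> u \<in> es ! s \<and> v \<in> es ! s} \<le> k}"
    by (auto simp: pair_count_take)
  also have "card \<dots> = min k (card {t. t < length es \<and> u \<in> es ! t \<and> v \<in> es ! t})"
    using card_first[of "length es" "\<lambda>t. u \<in> es ! t \<and> v \<in> es ! t"] by simp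
  finally show ?thesis .
qed

lemma min_pair_count:
  assumes "hypergraph V (mset es)" "t < length es"
  shows min_pair_count_le: "u \<in> es ! t \<Longrightarrow> v \<in> es ! t \<Longrightarrow>
      min_pair_count (take (Suc t) es) \<le> pair_count (take (Suc t) es) u v"
    and min_pair_count_attained: "\<exists>u\<in>es ! t. \<exists>v\<in>es ! t.
      min_pair_count (take (Suc t) es) = pair_count (take (Suc t) es) u v"
proof -
  have "es ! t \<in># mset es" using assms(2) by simp
  hence e: "finite (es ! t)" "es ! t \<noteq> {}"
    using assms(1) by (auto simp: hypergraph_def intro: finite_subset)
  have last: "last (take (Suc t) es) = es ! t" using assms(2) by (simp add: take_Suc_conv_app_nth)
  let ?C = "(\<lambda>(u, v). pair_count (take (Suc t) es) u v) ` (es ! t \<times> es ! t)"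
  show "min_pair_count (take (Suc t) es) \<le> pair_count (take (Suc t) es) u v"
    if "u \<in> es ! t" "v \<in> es ! t"
    unfolding min_pair_count_def last using that e by (intro Min_le) auto
  have "Min ?C \<in> ?C" using e by (intro Min_in) auto
  thus "\<exists>u\<in>es ! t. \<exists>v\<in>es ! t. min_pair_count (take (Suc t) es) = pair_count (take (Suc t) es) u v"
    unfolding min_pair_count_def last by auto
qed

text \<open>Charge each such time to a pair attaining the minimum. Each of the
  \<open>(card V)\<^sup>2\<close> ordered pairs is charged only for its first \<open>k\<close>
  occurrences.\<close>

lemma card_min_pair_count_le:
  assumes "hypergraph V (mset es)"
  shows "card {t. t < length es \<and> min_pair_count (take (Suc t) es) \<le> k} \<le> (card V)\<^sup>2 * k"
proof -
  have fin: "finite V" using assms by (simp add: hypergraph_def)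
  let ?A = "\<lambda>(u, v). {t. t < length es \<and> u \<in> es ! t \<and> v \<in> es ! t \<and> pair_count (take (Suc t) es) u v \<le> k}"
  have "{t. t < length es \<and> min_pair_count (take (Suc t) es) \<le> k} \<subseteq> (\<Union>uv\<in>V \<times> V. ?A uv)"
  proof
    fix t assume t: "t \<in> {t. t < length es \<and> min_pair_count (take (Suc t) es) \<le> k}"
    then obtain u v where "u \<in> es ! t" "v \<in> es ! t"
      "min_pair_count (take (Suc t) es) = pair_count (take (Suc t) es) u v"
      using min_pair_count_attained[OF assms] by blast
    moreover have "es ! t \<subseteq> V" using t assms by (auto simp: hypergraph_def)
    ultimately show "t \<in> (\<Union>uv\<in>V \<times> V. ?A uv)" using t by auto
  qed
  hence "card {t. t < length es \<and> min_pair_count (take (Suc t) es) \<le> k} \<le> card (\<Union>uv\<in>V \<times> V. ?A uv)"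
    using fin by (intro card_mono) auto
  also have "\<dots> \<le> (\<Sum>uv\<in>V \<times> V. card (?A uv))" using fin by (intro card_UN_le) auto
  also have "\<dots> \<le> (\<Sum>uv\<in>V \<times> V. k)" by (intro sum_mono) (auto simp: card_pair_count_le)
  finally show ?thesis by (simp add: card_cartesian_product power2_eq_square)
qed

text \<open>The threshold \<open>k div (2 n\<^sup>2)\<close> discards at most \<open>k / 2\<close> hyperedges in total. If some crossing
  hyperedge has minimum above \<open>k\<close>, then one of its pairs both crosses and has occurred more than \<open>k\<close>
  times, and the first \<open>k\<close> hyperedges containing that pair have minimum at most \<open>k\<close>.\<close>

lemma card_crossing_in_range:
  assumes "hypergraph V (mset es)" "X \<subseteq> V" "X \<noteq> {}"
    and k: "k \<le> card {t. t < length es \<and> crosses V X (es ! t)}"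
  shows "k \<le> 2 * card {t. t < length es \<and> crosses V X (es ! t) \<and>
     k div (2 * (card V)\<^sup>2) < min_pair_count (take (Suc t) es) \<and> min_pair_count (take (Suc t) es) \<le> k}"
proof -
  let ?m = "\<lambda>t. min_pair_count (take (Suc t) es)" and ?x = "k div (2 * (card V)\<^sup>2)"
  let ?U = "{t. t < length es \<and> crosses V X (es ! t) \<and> ?m t \<le> k}"
  let ?L = "{t. t < length es \<and> ?m t \<le> ?x}"
  let ?G = "{t. t < length es \<and> crosses V X (es ! t) \<and> ?x < ?m t \<and> ?m t \<le> k}"
  have "k \<le> card ?U"
  proof (cases "\<exists>t<length es. crosses V X (es ! t) \<and> ?m t > k")
    case False
    hence "?U = {t. t < length es \<and> crosses V X (es ! t)}" by (auto simp: not_less)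
    thus ?thesis using k by simp
  next
    case True
    then obtain t where t: "t < length es" "crosses V X (es ! t)" "?m t > k" by auto
    \<comment> \<open>For \<open>X \<noteq> V\<close> the vertex \<open>v\<close> lies outside
      \<open>X\<close>, so every hyperedge containing both vertices crosses \<open>X\<close>. For
      \<open>X = V\<close> every hyperedge that meets \<open>X\<close> crosses, and any
      \<open>v\<close> serves.\<close>
    obtain u v where uv: "u \<in> es ! t" "v \<in> es ! t" "u \<in> X" "v \<in> X \<longrightarrow> X = V"
      using t(2) by (auto simp: crosses_def)
    have "k < pair_count (take (Suc t) es) u v"
      using min_pair_count_le[OF assms(1) t(1) uv(1,2)] t(3) by simp
    also have "\<dots> \<le> card {s. s < length es \<and> u \<in> es ! s \<and> v \<in> es ! s}"
      unfolding pair_count_take[OF t(1)] using t(1) by (intro card_mono) auto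
    finally have "k = card {s. s < length es \<and> u \<in> es ! s \<and> v \<in> es ! s \<and> pair_count (take (Suc s) es) u v \<le> k}"
      by (simp add: card_pair_count_le)
    also have "\<dots> \<le> card ?U"
      using uv min_pair_count_le[OF assms(1)]
      by (intro card_mono) (auto simp: crosses_def intro: order.trans)
    finally show ?thesis .
  qed
  also have "card ?U \<le> card (?G \<union> ?L)" by (intro card_mono) auto
  also have "\<dots> \<le> card ?G + card ?L" by (rule card_Un_le)
  finally have "k \<le> card ?G + (card V)\<^sup>2 * ?x"
    using card_min_pair_count_le[OF assms(1), of ?x] by simp
  moreover have "2 * ((card V)\<^sup>2 * ?x) \<le> k"
    using div_times_less_eq_dividend[of k "2 * (card V)\<^sup>2"] by (simp add: mult_ac)
  ultimately show ?thesis by linarith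
qed

subsection \<open>The program\<close>

text \<open>Memory layout: cell \<open>1\<close> holds the coin, cell \<open>2\<close> the index \<open>i |e| + j\<close> of the current pair of
  vertices, cell \<open>3\<close> the guess, cell \<open>4\<close> the minimum, cell \<open>5\<close> the number of arrivals, and cell
  \<open>6 + u n + v\<close> the counter of the pair \<open>(u, v)\<close>.\<close>

definition counter_address :: expr where
  "counter_address = Bin Add (Const 6) (Bin Add
     (Bin Mult (EdgeVert (Bin Quot (Load (Const 2)) EdgeSize)) NumVerts)
     (EdgeVert (Bin Rem (Load (Const 2)) EdgeSize)))"

text \<open>With cut-off subtraction, \<open>a - (a - b) = min a b\<close>. The minimum is initialized with the number of
  arrivals, which bounds every counter.\<close>

definition count_pairs :: com where
  "count_pairs = While (Bin Less (Load (Const 2)) (Bin Mult EdgeSize EdgeSize))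
     (Seq (Store counter_address (Bin Add (Load counter_address) (Const 1)))
     (Seq (Store (Const 4) (Bin Sub (Load (Const 4)) (Bin Sub (Load (Const 4)) (Load counter_address))))
          (Store (Const 2) (Bin Add (Load (Const 2)) (Const 1)))))"

definition choose_color :: com where
  "choose_color = If (Load (Const 1)) (Store (Const 0) (Const 1))
     (Seq (Sample (Const 3) (Bin Add (Bin Add (Msb NumVerts) (Msb NumVerts)) (Const 3)))
     (Seq (Sample (Const 0) (Bin Quot
             (Bin Shl (Const 1) (Bin Add (Msb (Load (Const 4))) (Load (Const 3))))
             (Bin Mult (Const 64) (Bin Mult (Bin Add (Const 1) (Msb NumVerts)) (Bin Add (Const 1) (Msb NumVerts))))))
          (Store (Const 0) (Bin Add (Load (Const 0)) (Const 1)))))"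

text \<open>The dummy store costs as much as the coin flip, so that the first timestep is not special.\<close>

definition flip_coin :: com where
  "flip_coin = If (Load (Const 5)) (Store (Const 3) (Const 0)) (Sample (Const 1) (Const 1))"

definition color_edge :: com where
  "color_edge =
     Seq (Store (Const 5) (Bin Add (Load (Const 5)) (Const 1)))
    (Seq (Store (Const 4) (Load (Const 5)))
    (Seq (Store (Const 2) (Const 0))
    (Seq count_pairs choose_color)))"

definition packing_algorithm :: online_algorithm where
  "packing_algorithm = (Seq flip_coin color_edge, 16)"

text \<open>\<open>2 ^ i\<close> is the guessed optimum. Sampling from
  \<open>{0..palette n i}\<close> offers \<open>palette n i + 1\<close> colors, hence at least one
  for every guess.\<close>

definition palette :: "nat \<Rightarrow> nat \<Rightarrow> nat" where
  "palette n i = 2 ^ i div (64 * (floor_log n + 1)\<^sup>2)"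

text \<open>Twice \<open>floor_log n\<close> comes from the threshold \<open>k / (2 n^2)\<close>;
  the \<open>3\<close> covers its factor \<open>2\<close> and the rounding to powers of two.\<close>

definition guess_range :: "nat \<Rightarrow> nat" where
  "guess_range n = 2 * floor_log n + 3"

definition color_pmf :: "nat \<Rightarrow> nat \<Rightarrow> nat \<Rightarrow> nat pmf" where
  "color_pmf n b k = (if b \<noteq> 0 then return_pmf 1 else
     bind_pmf (pmf_of_set {0..guess_range n}) (\<lambda>R.
       map_pmf Suc (pmf_of_set {0..palette n (floor_log k + R)})))"

text \<open>Here \<open>26\<close> is \<open>6\<close> for the coin, \<open>13\<close> for three
  initial stores and \<open>7\<close> for the final loop test; \<open>71\<close> is the cost of one
  round. Choosing the color costs \<open>6\<close> or \<open>40\<close>, depending on the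
  coin.\<close>

definition step_cost :: "nat \<Rightarrow> nat \<Rightarrow> nat" where
  "step_cost b s = 26 + 71 * s\<^sup>2 + (if b \<noteq> 0 then 6 else 40)"

text \<open>Cells \<open>0\<close>, \<open>2\<close>, \<open>3\<close> and \<open>4\<close> carry no
  information between timesteps, so random values written there preserve the invariant.\<close>

definition memory_inv :: "nat \<Rightarrow> nat set list \<Rightarrow> nat \<Rightarrow> memory \<Rightarrow> bool" where
  "memory_inv n p b m \<longleftrightarrow> m 1 = b \<and> m 5 = length p \<and>
     (\<forall>u<n. \<forall>v<n. m (6 + u * n + v) = pair_count p u v)"

section \<open>Execution of a single timestep\<close>

lemma pair_count_le: "pair_count p u v \<le> length p"
  by (simp add: pair_count_def)

lemma pair_count_snoc:
  "pair_count (p @ [e]) u v = pair_count p u v + of_bool (u \<in> e \<and> v \<in> e)"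
  by (simp add: pair_count_def)

lemma expr_cost_address: "expr_cost counter_address = 15"
  by (simp add: counter_address_def)

text \<open>Invariant rule for a counting loop with a deterministic body of constant cost
  \<open>k\<close>. The invariant is indexed by the round, and the induction is on the number
  \<open>Q - q\<close> of rounds left.\<close>

lemma loop_return:
  assumes "\<And>q m s. q < Q \<Longrightarrow> I q m \<Longrightarrow>
      b (m, s) \<and> (\<exists>m'. I (Suc q) m' \<and> f (m, s) = return_spmf (m', s + k))"
    and "\<And>m s. I Q m \<Longrightarrow> \<not> b (m, s)"
    and "q \<le> Q" "I q m"
  shows "\<exists>m'. I Q m' \<and> loop b f (m, s) = return_spmf (m', s + (Q - q) * (k :: nat))"
  using assms(3,4)
proof (induction "Q - q" arbitrary: q m s)
  case 0
  hence "q = Q" by simp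
  thus ?case using 0 assms(2) by (subst loop.simps) auto
next
  case (Suc d)
  hence q: "q < Q" by simp
  then obtain m' where m': "I (Suc q) m'" "f (m, s) = return_spmf (m', s + k)" "b (m, s)"
    using assms(1) Suc.prems by blast
  have "d = Q - Suc q" "Suc q \<le> Q" using Suc.hyps(2) q by auto
  from Suc.hyps(1)[OF this m'(1)]
  obtain m'' where "I Q m''" "loop b f (m', s + k) = return_spmf (m'', s + k + (Q - Suc q) * k)"
    by blast
  moreover have "s + k + (Q - Suc q) * k = s + (Q - q) * k"
    using q by (metis Suc_diff_Suc add.assoc mult_Suc)
  ultimately show ?case using m' by (subst loop.simps) (auto simp: bind_return_spmf)
qed

text \<open>Hyperedge \<open>r\<close> arrives after \<open>p\<close>, with coin \<open>b\<close>.
  The bounds keep intermediate values below \<open>2 ^ w\<close>, so truncation is harmless: the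
  first for addresses and the divisor of the palette, the second for times and colors, the third for
  small constants.\<close>

locale timestep =
  fixes w n t :: nat and r :: "nat list" and p :: "nat set list" and b :: nat
  assumes n: "1 \<le> n" and t: "t = Suc (length p)"
    and bounds: "64 * (n * n) < 2 ^ w" "8 * (t * (n * n)) + 1 < 2 ^ w" "100 < (2 :: nat) ^ w"
    and r: "distinct r" "r \<noteq> []" "set r \<subseteq> {..<n}"
    and b: "b \<le> 1"
begin

lemma truncate: "x < 2 ^ w \<Longrightarrow> take_bit w x = x" for x :: nat
  by (rule take_bit_nat_eq_self)

lemma truncate_small: "x \<le> 100 \<Longrightarrow> take_bit w x = x" for x :: nat
  using bounds by (intro truncate) simp

lemma word_pos: "0 < w" "2 \<le> w"
proof -
  have "\<not> w < 2"
  proof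
    assume "w < 2"
    hence "(2 :: nat) ^ w \<le> 2 ^ 2" by (intro power_increasing) auto
    thus False using bounds(3) by simp
  qed
  thus "0 < w" "2 \<le> w" by simp_all
qed

lemma small_numerals:
  "take_bit w 2 = (2 :: nat)" "take_bit w 3 = (3 :: nat)" "take_bit w 4 = (4 :: nat)"
  "take_bit w 5 = (5 :: nat)" "take_bit w 6 = (6 :: nat)" "take_bit w 64 = (64 :: nat)"
  by (rule truncate_small; simp)+

lemma size_le: "length r \<le> n"
proof -
  have "card (set r) \<le> card {..<n}" using r(3) by (intro card_mono) auto
  thus ?thesis using r(1) by (simp add: distinct_card)
qed

lemma truncate_sq: "x \<le> 6 + n * n \<Longrightarrow> take_bit w x = x" for x :: nat
  using bounds n by (intro truncate) (cases "n * n", auto)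

lemma truncate_time: "x \<le> t \<Longrightarrow> take_bit w x = x" for x :: nat
proof -
  have "t \<le> t * (n * n)" using n by simp
  thus "x \<le> t \<Longrightarrow> take_bit w x = x" using bounds by (intro truncate) linarith
qed

definition entry :: "nat \<Rightarrow> nat \<times> nat" where
  "entry q = (r ! (q div length r), r ! (q mod length r))"

definition address :: "nat \<times> nat \<Rightarrow> nat" where
  "address = (\<lambda>(u, v). 6 + u * n + v)"

lemma index_less:
  assumes "q < length r * length r"
  shows "q div length r < length r" "q mod length r < length r"
  using assms r(2) by (auto simp: less_mult_imp_div_less)

lemma entry_in: "q < length r * length r \<Longrightarrow> fst (entry q) \<in> set r \<and> snd (entry q) \<in> set r"
  using index_less by (simp add: entry_def)

text \<open>As \<open>r\<close> is distinct, no ordered pair is visited in two rounds, so no counter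
  is incremented twice in a timestep.\<close>

lemma entry_inj:
  assumes "q < length r * length r" "q' < length r * length r" "entry q = entry q'"
  shows "q = q'"
proof -
  have "q div length r = q' div length r" "q mod length r = q' mod length r"
    using assms index_less r(1) by (auto simp: entry_def nth_eq_iff_index_eq)
  thus ?thesis by (metis div_mult_mod_eq)
qed

lemma entry_image: "entry ` {..<length r * length r} = set r \<times> set r"
proof (intro subset_antisym subsetI)
  fix uv assume "uv \<in> set r \<times> set r"
  then obtain i j where ij: "i < length r" "j < length r" "uv = (r ! i, r ! j)"
    by (auto simp: in_set_conv_nth)
  have "i * length r + j < Suc i * length r" using ij by simp
  also have "\<dots> \<le> length r * length r" using ij by (intro mult_le_mono1) simp
  finally have "i * length r + j \<in> {..<length r * length r}" by simp
  moreover have "(i * length r + j) div length r = i" "(i * length r + j) mod length r = j"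
    using ij by (auto simp: div_add1_eq[of "i * length r"])
  hence "uv = entry (i * length r + j)" using ij by (simp add: entry_def)
  ultimately show "uv \<in> entry ` {..<length r * length r}" by blast
qed (use entry_in in \<open>auto simp: mem_Times_iff\<close>)

lemma address_le:
  assumes "u < n" "v < n" shows "address (u, v) < 6 + n * n"
proof -
  have "u * n + v < Suc u * n" using assms by simp
  also have "\<dots> \<le> n * n" using assms by (intro mult_le_mono1) simp
  finally show ?thesis by (simp add: address_def)
qed

lemma address_inj:
  assumes "v < n" "v' < n" "address (u, v) = address (u', v')"
  shows "(u, v) = (u', v')"
proof -
  have "u * n + v = u' * n + v'" using assms(3) by (simp add: address_def)
  hence "(u * n + v) div n = (u' * n + v') div n" "(u * n + v) mod n = (u' * n + v') mod n" by simp_all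
  thus ?thesis using assms by simp
qed

text \<open>Visited counters already have their value for \<open>p @ [set r]\<close>, which is the
  value entering the minimum. The inserted \<open>t\<close> is the initial content of cell
  \<open>4\<close> and makes \<open>Min\<close> meaningful before the first round.\<close>

definition loop_inv :: "nat \<Rightarrow> memory \<Rightarrow> bool" where
  "loop_inv q m \<longleftrightarrow> m 1 = b \<and> m 2 = q \<and> m 5 = t \<and>
     (\<forall>u<n. \<forall>v<n. m (address (u, v)) = pair_count p u v + of_bool ((u, v) \<in> entry ` {..<q})) \<and>
     m 4 = Min (insert t ((\<lambda>q. case_prod (pair_count (p @ [set r])) (entry q)) ` {..<q}))"

lemma loop_index_le: "q \<le> length r * length r \<Longrightarrow> q \<le> 6 + n * n"
  using mult_le_mono[OF size_le size_le] by simp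

lemma eval_counter_address:
  assumes "m 2 = q" "q < length r * length r"
  shows "eval_expr w n r counter_address m = address (entry q)"
proof -
  have q: "take_bit w q = q" using loop_index_le[of q] assms by (intro truncate_sq) simp
  have nn: "n \<le> n * n" by (rule le_square)
  hence sq: "length r \<le> 6 + n * n" using size_le by linarith
  hence s: "take_bit w (length r) = length r" by (rule truncate_sq)
  have n': "take_bit w n = n" using nn by (intro truncate_sq) linarith
  note i = index_less[OF assms(2)]
  have i': "take_bit w (q div length r) = q div length r" "take_bit w (q mod length r) = q mod length r"
    using i sq by (auto intro!: truncate_sq)
  have uv: "fst (entry q) < n" "snd (entry q) < n" using entry_in[OF assms(2)] r(3) by auto
  have le: "fst (entry q) * n + snd (entry q) < n * n"
    using address_le[OF uv] by (simp add: address_def case_prod_beta)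
  have "take_bit w (fst (entry q)) = fst (entry q)" "take_bit w (snd (entry q)) = snd (entry q)"
    "take_bit w (fst (entry q) * n) = fst (entry q) * n"
    "take_bit w (fst (entry q) * n + snd (entry q)) = fst (entry q) * n + snd (entry q)"
    "take_bit w (6 + (fst (entry q) * n + snd (entry q))) = 6 + (fst (entry q) * n + snd (entry q))"
    using le uv nn by (intro truncate_sq; linarith)+
  thus ?thesis
    using q s n' i i' assms(1)
    by (simp add: counter_address_def small_numerals word_pos entry_def address_def Let_def)
qed


lemma exec_count_pairs_body:
  assumes "q < length r * length r" "loop_inv q m"
  shows "\<exists>m'. loop_inv (Suc q) m' \<and>
    exec w n r (Seq (Store counter_address (Bin Add (Load counter_address) (Const 1)))
     (Seq (Store (Const 4) (Bin Sub (Load (Const 4)) (Bin Sub (Load (Const 4)) (Load counter_address))))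
          (Store (Const 2) (Bin Add (Load (Const 2)) (Const 1))))) (m, s) = return_spmf (m', s + 64)"
proof -
  define u v where "u = fst (entry q)" and "v = snd (entry q)"
  have entry: "entry q = (u, v)" by (simp add: u_def v_def)
  have uv: "u \<in> set r" "v \<in> set r" using entry_in[OF assms(1)] by (auto simp: u_def v_def)
  hence uvn: "u < n" "v < n" using r(3) by auto
  define A where "A = address (u, v)"
  have A: "A \<ge> 6" by (simp add: A_def address_def)
  define c where "c = pair_count p u v"
  have new: "(u, v) \<notin> entry ` {..<q}"
  proof
    assume "(u, v) \<in> entry ` {..<q}"
    then obtain q' where "q' < q" "entry q' = entry q" using entry by auto
    thus False using entry_inj[of q' q] assms(1) by simp
  qed
  have mA: "m A = c" using assms(2) uvn new by (simp add: loop_inv_def A_def c_def)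
  have m: "m 2 = q" "m 5 = t" "m 1 = b" using assms(2) by (auto simp: loop_inv_def)
  have c: "c < t" using pair_count_le[of p u v] t by (simp add: c_def)
  have m4: "m 4 \<le> t" using assms(2) by (simp add: loop_inv_def)
  define m' where "m' = m(A := c + 1, 4 := min (m 4) (c + 1), 2 := Suc q)"
  have eval: "eval_expr w n r counter_address m1 = A" if "m1 2 = q" for m1
    using eval_counter_address[of m1 q] that assms(1) entry by (simp add: A_def)
  have tb: "take_bit w q = q" "take_bit w (Suc q) = Suc q"
    using loop_index_le[of "Suc q"] assms(1) by (auto intro!: truncate_sq)
  have tb': "take_bit w c = c" "take_bit w (Suc c) = Suc c"
    "take_bit w (m 4) = m 4" "take_bit w (m 4 - Suc c) = m 4 - Suc c"
    "take_bit w (min (m 4) (Suc c)) = min (m 4) (Suc c)"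
    using c m4 by (auto intro!: truncate_time)
  have min: "m 4 - (m 4 - Suc c) = min (m 4) (Suc c)" by simp
  have exec: "exec w n r (Seq (Store counter_address (Bin Add (Load counter_address) (Const 1)))
     (Seq (Store (Const 4) (Bin Sub (Load (Const 4)) (Bin Sub (Load (Const 4)) (Load counter_address))))
          (Store (Const 2) (Bin Add (Load (Const 2)) (Const 1))))) (m, s) = return_spmf (m', s + 64)"
    using A by (simp add: eval m mA tb tb' small_numerals word_pos m'_def min expr_cost_address del: diff_diff_cancel)
  moreover have "loop_inv (Suc q) m'"
    unfolding loop_inv_def
  proof (intro conjI allI impI)
    have "pair_count (p @ [set r]) u v = c + 1" using uv by (simp add: pair_count_snoc c_def)
    thus "m' 4 = Min (insert t ((\<lambda>q. case_prod (pair_count (p @ [set r])) (entry q)) ` {..<Suc q}))"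
      using assms(2) A entry
      by (simp add: m'_def loop_inv_def lessThan_Suc insert_commute[of t] min.commute)
    fix u' v' assume uv': "u' < n" "v' < n"
    have low: "address (u', v') \<ge> 6" by (simp add: address_def)
    show "m' (address (u', v')) = pair_count p u' v' + of_bool ((u', v') \<in> entry ` {..<Suc q})"
    proof (cases "(u', v') = (u, v)")
      case True
      thus ?thesis using low entry by (simp add: m'_def A_def c_def lessThan_Suc)
    next
      case False
      hence "address (u', v') \<noteq> A" using address_inj uv' uvn unfolding A_def by blast
      moreover have "(u', v') \<in> entry ` {..<Suc q} \<longleftrightarrow> (u', v') \<in> entry ` {..<q}"
        using False entry by (auto simp: lessThan_Suc)
      moreover have "m (address (u', v')) = pair_count p u' v' + of_bool ((u', v') \<in> entry ` {..<q})"
        using assms(2) uv' by (simp add: loop_inv_def)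
      ultimately show ?thesis using low by (simp add: m'_def)
    qed
  qed (use A m in \<open>auto simp: m'_def\<close>)
  ultimately show ?thesis by blast
qed

lemma exec_count_pairs:
  assumes "loop_inv 0 m"
  shows "\<exists>m'. loop_inv (length r * length r) m' \<and>
    exec w n r count_pairs (m, s) = return_spmf (m', s + 71 * (length r)\<^sup>2 + 7)"
proof -
  let ?Q = "length r * length r"
  have tb: "take_bit w q = q" if "q \<le> ?Q" for q
    using loop_index_le[OF that] by (rule truncate_sq)
  have s: "take_bit w (length r) = length r" using le_square[of "length r"] by (intro tb)
  let ?body = "Seq (Store counter_address (Bin Add (Load counter_address) (Const 1)))
     (Seq (Store (Const 4) (Bin Sub (Load (Const 4)) (Bin Sub (Load (Const 4)) (Load counter_address))))
          (Store (Const 2) (Bin Add (Load (Const 2)) (Const 1))))"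
  let ?guard = "Bin Less (Load (Const 2)) (Bin Mult EdgeSize EdgeSize)"
  have guard: "eval_expr w n r ?guard m = of_bool (q < ?Q)" if "q \<le> ?Q" "loop_inv q m" for q m
    using that tb[of q] tb[of ?Q] s by (simp add: loop_inv_def small_numerals word_pos)
  have "\<exists>m'. loop_inv ?Q m' \<and>
      loop (\<lambda>(m, s). eval_expr w n r ?guard m \<noteq> 0)
        (\<lambda>(m, s). exec w n r ?body (m, s + 1 + expr_cost ?guard)) (m, s)
      = return_spmf (m', s + (?Q - 0) * 71)"
  proof (rule loop_return[where I = loop_inv])
    fix q m s assume q: "q < ?Q" "loop_inv q m"
    show "(case (m, s) of (m, s) \<Rightarrow> eval_expr w n r ?guard m \<noteq> 0) \<and>
       (\<exists>m'. loop_inv (Suc q) m' \<and>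
         (case (m, s) of (m, s) \<Rightarrow> exec w n r ?body (m, s + 1 + expr_cost ?guard)) = return_spmf (m', s + 71))"
    proof -
      have "s + 1 + expr_cost ?guard + 64 = s + 71" by simp
      thus ?thesis
        using exec_count_pairs_body[OF q, of "s + 1 + expr_cost ?guard"] guard[of q m] q
        unfolding prod.case by (simp add: ac_simps del: exec.simps eval_expr.simps expr_cost.simps)
    qed
  next
    fix m s assume "loop_inv ?Q m"
    thus "\<not> (case (m, s) of (m, s) \<Rightarrow> eval_expr w n r ?guard m \<noteq> 0)"
      using guard[of ?Q m] by (simp del: eval_expr.simps)
  qed (use assms in auto)
  then obtain m' where "loop_inv ?Q m'"
    "loop (\<lambda>(m, s). eval_expr w n r ?guard m \<noteq> 0)
        (\<lambda>(m, s). exec w n r ?body (m, s + 1 + expr_cost ?guard)) (m, s)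
      = return_spmf (m', s + (?Q - 0) * 71)" by blast
  hence "exec w n r count_pairs (m, s) = return_spmf (m', s + 71 * (length r)\<^sup>2 + 7)"
    unfolding count_pairs_def exec.simps(6) by (simp add: power2_eq_square del: eval_expr.simps exec.simps)
  thus ?thesis using \<open>loop_inv ?Q m'\<close> by blast
qed

definition guess_step :: "memory \<times> nat \<Rightarrow> (memory \<times> nat) spmf" where
  "guess_step = (\<lambda>(m, s). bind_spmf (spmf_of_set {0..guess_range n}) (\<lambda>R.
     bind_spmf (spmf_of_set {0..palette n (floor_log (m 4) + R)}) (\<lambda>x.
       return_spmf (m(3 := R, 0 := Suc x), s + 37))))"

text \<open>Since \<open>2 ^ floor_log k \<le> t\<close> and
  \<open>2 ^ guess_range n \<le> 8 * (n * n)\<close>, even the largest guess produces a shift that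
  fits into a word.\<close>

lemma palette_bound:
  assumes "0 < k" "k \<le> t" "R \<le> guess_range n"
  shows "2 ^ (floor_log k + R) \<le> 8 * (t * (n * n))"
proof -
  have "(2::nat) ^ (floor_log k + R) \<le> 2 ^ floor_log k * 2 ^ guess_range n"
    using assms(3) by (simp add: power_add)
  also have "2 ^ guess_range n = 8 * (2 ^ floor_log n * (2 ^ floor_log n :: nat))"
  proof -
    have range: "guess_range n = 3 + (floor_log n + floor_log n)" by (simp add: guess_range_def)
    show ?thesis unfolding range power_add by simp
  qed
  also have "2 ^ floor_log k * (8 * (2 ^ floor_log n * 2 ^ floor_log n)) \<le> t * (8 * (n * n))"
    using assms n floor_log_exp2_le[of k] floor_log_exp2_le[of n]
    by (intro mult_le_mono) auto
  finally show ?thesis by (simp add: mult_ac)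
qed

lemma exec_choose_color:
  assumes "m 1 = b" "0 < m 4" "m 4 \<le> t"
  shows "exec w n r choose_color (m, s) =
    (if b \<noteq> 0 then return_spmf (m(0 := 1), s + 6) else guess_step (m, s + 3))"
proof -
  have l1: "floor_log n < n" using n floor_log_exp2_le[of n] by (metis less_exp order.strict_trans2 zero_less_iff_neq_zero not_one_le_zero)
  have l2: "floor_log (m 4) < m 4" using assms floor_log_exp2_le[of "m 4"] by (metis less_exp order.strict_trans2)
  have nn: "n \<le> n * n" by (rule le_square)
  have ll: "Suc (floor_log n) * Suc (floor_log n) \<le> n * n" using l1 by (intro mult_le_mono) auto
  have tb: "take_bit w n = n" "take_bit w (floor_log n) = floor_log n"
    "take_bit w (Suc (floor_log n)) = Suc (floor_log n)"
    "take_bit w (floor_log n + floor_log n) = floor_log n + floor_log n"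
    "take_bit w (floor_log n + floor_log n + 3) = floor_log n + floor_log n + 3"
    "take_bit w (Suc (floor_log n) * Suc (floor_log n)) = Suc (floor_log n) * Suc (floor_log n)"
    "take_bit w (64 * (Suc (floor_log n) * Suc (floor_log n))) = 64 * (Suc (floor_log n) * Suc (floor_log n))"
    using bounds(1) ll l1 nn n by (intro truncate; linarith)+
  have tb': "take_bit w (m 4) = m 4" "take_bit w (floor_log (m 4)) = floor_log (m 4)"
    using l2 assms by (auto intro!: truncate_time)
  have tbb: "take_bit w b = b" using b by (intro truncate_small) simp
  have tbR: "take_bit w R = R" "take_bit w (floor_log (m 4) + R) = floor_log (m 4) + R"
    "floor_log (m 4) + R < w"
    "take_bit w (palette n (floor_log (m 4) + R)) = palette n (floor_log (m 4) + R)"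
    "x \<le> palette n (floor_log (m 4) + R) \<Longrightarrow> take_bit w x = x"
    "x \<le> palette n (floor_log (m 4) + R) \<Longrightarrow> take_bit w (Suc x) = Suc x"
    if "R \<le> guess_range n" for R x
  proof -
    \<comment> \<open>The \<open>+ 1\<close> in the second word-size bound leaves room for the final
      increment of the sampled color.\<close>
    have B: "2 ^ (floor_log (m 4) + R) < (2::nat) ^ w" "Suc (2 ^ (floor_log (m 4) + R)) < (2::nat) ^ w"
      using palette_bound[OF assms(2,3) that] bounds(2) by linarith+
    have "palette n (floor_log (m 4) + R) \<le> 2 ^ (floor_log (m 4) + R)" by (simp add: palette_def)
    moreover have "floor_log (m 4) + R < 2 ^ (floor_log (m 4) + R)" by (rule less_exp)
    ultimately show "take_bit w R = R" "take_bit w (floor_log (m 4) + R) = floor_log (m 4) + R"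
      "take_bit w (palette n (floor_log (m 4) + R)) = palette n (floor_log (m 4) + R)"
      "x \<le> palette n (floor_log (m 4) + R) \<Longrightarrow> take_bit w x = x"
      "x \<le> palette n (floor_log (m 4) + R) \<Longrightarrow> take_bit w (Suc x) = Suc x"
      using B(2) by (intro truncate; linarith)+
    show "floor_log (m 4) + R < w" using B(1) by simp
  qed
  show ?thesis
  proof (cases "b = 0")
    case False
    thus ?thesis using assms tbb by (simp add: choose_color_def word_pos)
  next
    case True
    have pal: "2 ^ i div (64 * (Suc (floor_log n) * Suc (floor_log n))) = palette n i" for i
      by (simp add: palette_def power2_eq_square)
    have one: "k * Suc 0 = k" "Suc 0 * k = k" for k by simp_all
    have range: "floor_log n + floor_log n + 3 = guess_range n" by (simp add: guess_range_def)
    show ?thesis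
      using assms(1) True
      by (auto simp: choose_color_def guess_step_def word_pos tb tb' tbR small_numerals bind_map_spmf
          o_def pal range push_bit_eq_mult one map_spmf_conv_bind_spmf set_spmf_of_set
          simp del: mult_Suc mult_Suc_right intro!: bind_spmf_cong)
  qed
qed

lemma exec_color_edge:
  assumes "memory_inv n p b m"
  shows "\<exists>m'. memory_inv n (p @ [set r]) b m' \<and> m' 4 = min_pair_count (p @ [set r]) \<and>
    exec w n r color_edge (m, s) =
      (let s' = s + 20 + 71 * (length r)\<^sup>2 in
       if b \<noteq> 0 then return_spmf (m'(0 := 1), s' + 6) else guess_step (m', s' + 3))"
proof -
  define m0 where "m0 = m(5 := t, 4 := t, 2 := 0)"
  have m: "m 1 = b" "m 5 = length p" "\<And>u v. u < n \<Longrightarrow> v < n \<Longrightarrow> m (address (u, v)) = pair_count p u v"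
    using assms by (auto simp: memory_inv_def address_def)
  have low: "address uv \<ge> 6" for uv by (simp add: address_def case_prod_beta)
  have tb: "take_bit w (length p) = length p" "take_bit w t = t" "take_bit w (Suc (length p)) = Suc (length p)"
    using t by (auto intro!: truncate_time)
  have "m0 (address uv) = m (address uv)" for uv
    using low[of uv] by (auto simp: m0_def)
  hence "loop_inv 0 m0" using m by (simp add: loop_inv_def) (simp add: m0_def)
  from exec_count_pairs[OF this, of "s + 13"] obtain m' where m':
    "loop_inv (length r * length r) m'"
    "exec w n r count_pairs (m0, s + 13) = return_spmf (m', s + 13 + 71 * (length r)\<^sup>2 + 7)" by blast
  have count: "pair_count (p @ [set r]) u v \<le> t" for u v
    using pair_count_le[of "p @ [set r]" u v] t by simp
  let ?C = "case_prod (pair_count (p @ [set r])) ` (set r \<times> set r)"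
  have ne: "?C \<noteq> {}" using r by simp
  have "m' 4 = Min (insert t ?C)"
    using m'(1) by (simp add: loop_inv_def flip: entry_image) (simp add: image_image)
  also have "\<dots> = Min ?C"
  proof -
    have "Min ?C \<in> ?C" using ne by (intro Min_in) auto
    hence "Min ?C \<le> t" using count by auto
    hence "min t (Min ?C) = Min ?C" by (rule min_absorb2)
    moreover have "Min (insert t ?C) = min t (Min ?C)" using ne by (intro Min_insert) auto
    ultimately show ?thesis by simp
  qed
  also have "\<dots> = min_pair_count (p @ [set r])" by (simp add: min_pair_count_def)
  finally have m4: "m' 4 = min_pair_count (p @ [set r])" .
  have "Min ?C \<in> ?C" using ne by (intro Min_in) auto
  then obtain u v where "u \<in> set r" "v \<in> set r" "Min ?C = pair_count (p @ [set r]) u v" by auto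
  moreover from this have "m' 4 = pair_count (p @ [set r]) u v"
    using m4 unfolding min_pair_count_def by simp
  ultimately have pos: "0 < m' 4" "m' 4 \<le> t"
    using count[of u v] by (simp_all add: pair_count_snoc)
  have inv: "memory_inv n (p @ [set r]) b m'"
    unfolding memory_inv_def
  proof (intro conjI allI impI)
    show "m' 1 = b" "m' 5 = length (p @ [set r])" using m'(1) unfolding loop_inv_def by (simp_all add: t)
    fix u v assume "u < n" "v < n"
    thus "m' (6 + u * n + v) = pair_count (p @ [set r]) u v"
      using m'(1) unfolding loop_inv_def entry_image
      by (auto simp: pair_count_snoc address_def)
  qed
  have "exec w n r color_edge (m, s) = exec w n r (Seq count_pairs choose_color) (m0, s + 13)"
    using m t tb by (simp add: color_edge_def small_numerals word_pos m0_def)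
      (simp add: eval_nat_numeral)
  also have "\<dots> = exec w n r choose_color (m', s + 20 + 71 * (length r)\<^sup>2)"
    using m'(2) by (simp add: ac_simps)
  also have "\<dots> = (if b \<noteq> 0 then return_spmf (m'(0 := 1), s + 20 + 71 * (length r)\<^sup>2 + 6)
      else guess_step (m', s + 20 + 71 * (length r)\<^sup>2 + 3))"
    using m'(1) pos by (intro exec_choose_color) (auto simp: loop_inv_def)
  finally show ?thesis using inv m4 by (auto simp: Let_def)
qed

end

subsection \<open>The output distribution\<close>

context timestep
begin

text \<open>The random outcomes of a timestep only touch cells outside the invariant, so the
  continuation has the same distribution \<open>Y\<close> after all of them. This is the step that
  separates the current color from the later ones.\<close>

lemma exec_color_edge_bind:
  assumes "memory_inv n p b m" "\<And>m'. memory_inv n (p @ [set r]) b m' \<Longrightarrow> X m' = Y"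
  shows "bind_spmf (exec w n r color_edge (m, s)) (\<lambda>(m', s'). map_spmf (\<lambda>out. (m' 0, s') # out) (X m'))
    = bind_spmf (spmf_of_pmf (color_pmf n b (min_pair_count (p @ [set r]))))
        (\<lambda>c. map_spmf (\<lambda>out. (c, s + 20 + 71 * (length r)\<^sup>2 + (if b \<noteq> 0 then 6 else 40)) # out) Y)"
proof -
  obtain m' where m': "memory_inv n (p @ [set r]) b m'" "m' 4 = min_pair_count (p @ [set r])"
    "exec w n r color_edge (m, s) =
      (let s' = s + 20 + 71 * (length r)\<^sup>2 in
       if b \<noteq> 0 then return_spmf (m'(0 := 1), s' + 6) else guess_step (m', s' + 3))"
    using exec_color_edge[OF assms(1)] by blast
  have X: "X (m'(3 := x, 0 := y)) = Y" "X (m'(0 := y)) = Y" for x y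
    by (rule assms(2), use m'(1) in \<open>simp add: memory_inv_def\<close>)+
  have uniform: "spmf_of_set {0..k} = spmf_of_pmf (pmf_of_set {0..k})" for k :: nat
    by simp
  show ?thesis
  proof (cases "b = 0")
    case True
    have "bind_spmf (exec w n r color_edge (m, s)) (\<lambda>(m', s'). map_spmf (\<lambda>out. (m' 0, s') # out) (X m'))
      = bind_spmf (spmf_of_set {0..guess_range n}) (\<lambda>R.
          bind_spmf (spmf_of_set {0..palette n (floor_log (min_pair_count (p @ [set r])) + R)}) (\<lambda>x.
            map_spmf (\<lambda>out. (Suc x, s + 20 + 71 * (length r)\<^sup>2 + 40) # out) Y))"
      using True m'(2) by (simp add: m'(3) Let_def guess_step_def X)
    also have "\<dots> = bind_spmf (spmf_of_pmf (color_pmf n b (min_pair_count (p @ [set r]))))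
        (\<lambda>c. map_spmf (\<lambda>out. (c, s + 20 + 71 * (length r)\<^sup>2 + 40) # out) Y)"
      unfolding uniform bind_spmf_of_pmf color_pmf_def
      using True by (simp add: bind_assoc_pmf bind_map_pmf del: spmf_of_pmf_pmf_of_set)
    finally show ?thesis using True by simp
  next
    case False
    thus ?thesis by (simp add: m'(3) X color_pmf_def Let_def bind_return_pmf)
  qed
qed

end

text \<open>With factor \<open>16\<close>, \<open>2 ^ w\<close> is at least
  \<open>(n + t) ^ 16\<close>. Since \<open>n + t \<ge> 2\<close>, thirteen of these factors give
  \<open>8192\<close>, and the remaining cube dominates \<open>t * (n * n)\<close>,
  \<open>n * n\<close> and \<open>1\<close>.\<close>

lemma timestep_word_size:
  assumes "1 \<le> n" "t = Suc (length p)" "distinct r" "r \<noteq> []" "set r \<subseteq> {..<n}" "b \<le> 1"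
  shows "timestep (word_size 16 n t) n t r p b"
proof
  let ?N = "n + t"
  have N: "2 \<le> ?N" using assms by simp
  have "?N ^ 16 \<le> (2 ^ ceillog2 ?N) ^ 16" by (intro power_mono le_two_power_ceillog2) simp
  also have "\<dots> = 2 ^ word_size 16 n t" by (simp add: word_size_def mult.commute flip: power_mult)
  finally have "?N ^ 13 * ?N ^ 3 \<le> 2 ^ word_size 16 n t" by (simp flip: power_add)
  moreover have "(2::nat) ^ 13 \<le> ?N ^ 13" using N by (intro power_mono) auto
  hence "2 ^ 13 * ?N ^ 3 \<le> ?N ^ 13 * ?N ^ 3" by (intro mult_le_mono1)
  ultimately have big: "8192 * ?N ^ 3 \<le> 2 ^ word_size 16 n t" by simp
  have cube: "?N ^ 3 = ?N * (?N * ?N)" by (simp add: power3_eq_cube)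
  have nn: "n * n \<le> ?N * ?N" by (intro mult_le_mono) auto
  have "t * (n * n) \<le> ?N ^ 3" unfolding cube using nn by (intro mult_le_mono) auto
  moreover have "1 * (n * n) \<le> ?N ^ 3" unfolding cube using nn N by (intro mult_le_mono) auto
  moreover have "1 \<le> ?N ^ 3" using N by simp
  ultimately show "64 * (n * n) < 2 ^ word_size 16 n t" "8 * (t * (n * n)) + 1 < 2 ^ word_size 16 n t"
    "100 < (2 :: nat) ^ word_size 16 n t" using big by linarith+
qed (use assms in auto)

text \<open>\<open>p\<close> is the history before \<open>es\<close>. Each distribution depends on
  the hyperedges so far and on the coin, but not on earlier guesses or colors, which is why
  independent sampling describes a run with a fixed coin.\<close>

definition color_pmfs :: "nat \<Rightarrow> nat \<Rightarrow> nat set list \<Rightarrow> nat set list \<Rightarrow> nat pmf list" where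
  "color_pmfs n b p es =
     map (\<lambda>t. color_pmf n b (min_pair_count (p @ take (Suc t) es))) [0..<length es]"

lemma color_pmfs_Nil [simp]: "color_pmfs n b p [] = []"
  by (simp add: color_pmfs_def)

lemma color_pmfs_Cons [simp]:
  "color_pmfs n b p (e # es) = color_pmf n b (min_pair_count (p @ [e])) # color_pmfs n b (p @ [e]) es"
  unfolding color_pmfs_def by (simp add: map_upt_Suc del: upt_Suc)

definition output_pmf :: "nat \<Rightarrow> nat \<Rightarrow> nat set list \<Rightarrow> nat list list \<Rightarrow> (nat \<times> nat) list pmf" where
  "output_pmf n b p rs = map_pmf (\<lambda>cs. zip cs (map (step_cost b \<circ> length) rs))
     (indep_pmf (color_pmfs n b p (map set rs)))"

lemma output_pmf_Cons:
  "spmf_of_pmf (output_pmf n b p (r # rs)) =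
     bind_spmf (spmf_of_pmf (color_pmf n b (min_pair_count (p @ [set r]))))
       (\<lambda>c. map_spmf (\<lambda>out. (c, step_cost b (length r)) # out) (spmf_of_pmf (output_pmf n b (p @ [set r]) rs)))"
  by (simp add: output_pmf_def spmf_of_pmf_bind map_bind_pmf pmf.map_comp o_def)

text \<open>As \<open>p\<close> is nonempty, the arrival count in cell \<open>5\<close> is not
  \<open>0\<close>, so the coin keeps its value and \<open>flip_coin\<close> only overwrites cell
  \<open>3\<close>.\<close>

lemma run_from_eq:
  assumes "1 \<le> n" "b \<le> 1" "p \<noteq> []" "memory_inv n p b m"
    and "\<And>r. r \<in> set rs \<Longrightarrow> distinct r \<and> r \<noteq> [] \<and> set r \<subseteq> {..<n}"
  shows "run_from packing_algorithm n rs (Suc (length p)) m = spmf_of_pmf (output_pmf n b p rs)"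
  using assms(3-)
proof (induction rs arbitrary: p m)
  case Nil
  thus ?case by (simp add: output_pmf_def)
next
  case (Cons r rs)
  let ?w = "word_size 16 n (Suc (length p))"
  interpret timestep ?w n "Suc (length p)" r p b
    using assms Cons.prems by (intro timestep_word_size) auto
  have IH: "run_from packing_algorithm n rs (Suc (Suc (length p))) m' = spmf_of_pmf (output_pmf n b (p @ [set r]) rs)"
    if "memory_inv n (p @ [set r]) b m'" for m'
    using Cons.IH[of "p @ [set r]" m'] that Cons.prems by simp
  have m3: "memory_inv n p b (m(3 := 0))" using Cons.prems by (simp add: memory_inv_def)
  have "take_bit ?w (m 5) \<noteq> 0"
    using Cons.prems truncate_time[of "length p"] by (simp add: memory_inv_def)
  hence "exec ?w n r flip_coin (m, 0) = return_spmf (m(3 := 0), 6)"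
    by (simp add: flip_coin_def small_numerals word_pos)
  hence "run_from packing_algorithm n (r # rs) (Suc (length p)) m =
      bind_spmf (exec ?w n r color_edge (m(3 := 0), 6))
        (\<lambda>(m', s). map_spmf (\<lambda>out. (m' 0, s) # out) (run_from packing_algorithm n rs (Suc (Suc (length p))) m'))"
    by (simp add: packing_algorithm_def)
  also have "\<dots> = spmf_of_pmf (output_pmf n b p (r # rs))"
    unfolding output_pmf_Cons
    by (subst exec_color_edge_bind[OF m3 IH]) (auto simp: step_cost_def add_ac)
  finally show ?case .
qed

text \<open>The first timestep flips the coin in zero memory; conditioned on its value the rest is
  covered by \<open>run_from_eq\<close>. The empty input flips no coin, but averaging over one
  leaves its empty output unchanged.\<close>

lemma run_packing_algorithm:
  assumes "1 \<le> n" "\<forall>r\<in>set rs. distinct r \<and> r \<noteq> [] \<and> set r \<subseteq> {..<n}"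
  shows "run packing_algorithm n rs = spmf_of_pmf (bind_pmf (pmf_of_set {0..1}) (\<lambda>b. output_pmf n b [] rs))"
proof (cases rs)
  case Nil
  thus ?thesis by (simp add: run_def output_pmf_def)
next
  case (Cons r rs')
  let ?w = "word_size 16 n 1"
  have ts: "timestep ?w n 1 r [] b" if "b \<le> 1" for b
    using assms that by (intro timestep_word_size) (auto simp: Cons)
  interpret timestep ?w n 1 r "[]" 0 using ts by simp
  have coin: "exec ?w n r flip_coin (\<lambda>_. 0, 0) =
      bind_spmf (spmf_of_set {0..1}) (\<lambda>b. return_spmf ((\<lambda>_. 0)(1 := b), 6))"
    by (simp add: flip_coin_def small_numerals word_pos[unfolded One_nat_def] map_spmf_conv_bind_spmf)
      (simp add: eval_nat_numeral)
  have uniform: "spmf_of_set {0..k} = spmf_of_pmf (pmf_of_set {0..k})" for k :: nat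
    by simp
  have "run packing_algorithm n rs = bind_spmf (spmf_of_set {0..1}) (\<lambda>b.
      bind_spmf (exec ?w n r color_edge ((\<lambda>_. 0)(1 := b), 6))
        (\<lambda>(m', s). map_spmf (\<lambda>out. (m' 0, s) # out) (run_from packing_algorithm n rs' 2 m')))"
    using coin by (simp add: run_def Cons packing_algorithm_def numeral_2_eq_2)
  also have "\<dots> = bind_spmf (spmf_of_set {0..1}) (\<lambda>b. spmf_of_pmf (output_pmf n b [] rs))"
  proof (intro bind_spmf_cong refl)
    fix b :: nat assume "b \<in> set_spmf (spmf_of_set {0..1})"
    hence b: "b \<le> 1" by (simp add: set_spmf_of_set)
    have inv: "memory_inv n [] b ((\<lambda>_. 0)(1 := b))"
      by (simp add: memory_inv_def pair_count_def)
    have run: "run_from packing_algorithm n rs' 2 m' = spmf_of_pmf (output_pmf n b ([] @ [set r]) rs')"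
      if "memory_inv n ([] @ [set r]) b m'" for m'
      using run_from_eq[OF assms(1) b _ that, of rs'] assms(2) by (simp add: Cons numeral_2_eq_2)
    show "bind_spmf (exec ?w n r color_edge ((\<lambda>_. 0)(1 := b), 6))
        (\<lambda>(m', s). map_spmf (\<lambda>out. (m' 0, s) # out) (run_from packing_algorithm n rs' 2 m'))
      = spmf_of_pmf (output_pmf n b [] rs)"
      unfolding Cons output_pmf_Cons
      by (subst timestep.exec_color_edge_bind[OF ts[OF b] inv run]) (auto simp: step_cost_def add_ac)
  qed
  finally show ?thesis unfolding uniform bind_spmf_of_pmf by (simp add: spmf_of_pmf_bind)
qed

subsection \<open>Competitive ratio and running time\<close>

text \<open>Over a nonempty \<open>V\<close> each packed subhypergraph contains a hyperedge, so
  packings have at most \<open>size E\<close> members. The empty packing shows that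
  \<open>Max\<close> is taken over a nonempty set.\<close>

lemma opt_attained:
  assumes "hypergraph V E"
  obtains Fs where "length Fs = opt V E" "\<And>F. F \<in> set Fs \<Longrightarrow> connected_spanning V F" "sum_list Fs \<subseteq># E"
proof -
  let ?S = "{k. \<exists>Fs. length Fs = k \<and> (\<forall>F\<in>set Fs. connected_spanning V F) \<and> sum_list Fs \<subseteq># E}"
  have V: "V \<noteq> {}" using assms by (simp add: hypergraph_def)
  have len: "length Fs \<le> size (sum_list Fs)" if "\<forall>F\<in>set Fs. connected_spanning V F" for Fs
    using that
  proof (induction Fs)
    case (Cons F Fs)
    hence "0 < size F" using connected_spanning_nonempty[of V F] V by (auto simp: nonempty_has_size)
    thus ?case using Cons by simp
  qed simp
  have "?S \<subseteq> {..size E}"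
    using len by (auto dest: size_mset_mono intro: order.trans)
  hence "finite ?S" by (rule finite_subset) simp
  moreover have "0 \<in> ?S" by simp
  ultimately have "Max ?S \<in> ?S" by (intro Max_in) blast+
  thus ?thesis using that unfolding opt_def by blast
qed

text \<open>Each member of an optimal packing contributes a crossing hyperedge of its own.\<close>

lemma opt_le_crossing:
  assumes "hypergraph V (mset es)" "X \<subseteq> V" "X \<noteq> {}"
  shows "opt V (mset es) \<le> card {t. t < length es \<and> crosses V X (es ! t)}"
proof -
  obtain Fs where Fs: "length Fs = opt V (mset es)" "\<And>F. F \<in> set Fs \<Longrightarrow> connected_spanning V F"
    "sum_list Fs \<subseteq># mset es" using opt_attained[OF assms(1)] by blast
  have "length Fs \<le> size (filter_mset (crosses V X) (sum_list Fs))" using Fs(2)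
  proof (induction Fs)
    case (Cons F Fs)
    then obtain e where "e \<in># filter_mset (crosses V X) F"
      using connected_spanning_crosses[of V F X] assms by auto
    hence "0 < size (filter_mset (crosses V X) F)" by (auto simp: nonempty_has_size[symmetric])
    thus ?case using Cons by simp
  qed simp
  also have "\<dots> \<le> size (filter_mset (crosses V X) (mset es))"
    using Fs(3) by (intro size_mset_mono multiset_filter_mono)
  also have "\<dots> = card {t. t < length es \<and> crosses V X (es ! t)}"
    by (simp flip: mset_filter add: length_filter_conv_card)
  finally show ?thesis using Fs(1) by simp
qed

lemma connected_spanning_if_opt_pos:
  assumes "hypergraph V E" "0 < opt V E" shows "connected_spanning V E"
proof -
  obtain Fs where Fs: "length Fs = opt V E" "\<And>F. F \<in> set Fs \<Longrightarrow> connected_spanning V F"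
    "sum_list Fs \<subseteq># E" using opt_attained[OF assms(1)] by blast
  then obtain F Fs' where "Fs = F # Fs'" using assms(2) by (cases Fs) auto
  hence "connected_spanning V F" "F \<subseteq># E" using Fs by (auto intro: mset_subset_eq_add_left subset_mset.trans)
  thus ?thesis using connected_spanning_mono assms(1) by blast
qed

section \<open>Subhypergraphs selected by independent bits\<close>

definition selected :: "'v set list \<Rightarrow> bool list \<Rightarrow> 'v set multiset" where
  "selected es b = mset (map fst (filter snd (zip es b)))"

lemma color_class_eq_selected: "color_class es cs c = selected es (map (\<lambda>c'. c' = c) cs)"
  by (simp add: color_class_def selected_def zip_map2 filter_map o_def case_prod_beta)

lemma selected_mono: "list_all2 (\<longrightarrow>) b b' \<Longrightarrow> selected es b \<subseteq># selected es b'"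
proof (induction b b' arbitrary: es rule: list_all2_induct)
  case (Cons x b y b')
  show ?case
  proof (cases es)
    case (Cons e es')
    thus ?thesis using Cons.IH[of es'] Cons.hyps by (auto simp: selected_def intro: subset_mset.order_trans)
  qed (simp add: selected_def)
qed simp

lemma selected_subset: "selected es b \<subseteq># mset es"
proof (induction es arbitrary: b)
  case (Cons e es)
  show ?case
  proof (cases b)
    case (Cons x b')
    thus ?thesis using Cons.IH[of b'] by (auto simp: selected_def intro: subset_mset.order_trans)
  qed (simp add: selected_def)
qed (simp add: selected_def)

lemma nth_in_selected:
  assumes "t < length es" "length b = length es" "b ! t" shows "es ! t \<in># selected es b"
proof -
  have "(es ! t, b ! t) \<in> set (zip es b)" using assms by (auto simp: set_zip)
  thus ?thesis using assms(3) by (force simp: selected_def)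
qed

lemma hypergraph_subset: "hypergraph V G \<Longrightarrow> F \<subseteq># G \<Longrightarrow> hypergraph V F"
  by (auto simp: hypergraph_def dest: mset_subset_eqD)

text \<open>Double counting: every component of the selected subhypergraph is crossed by at least
  \<open>k / 2\<close> of the frequently selected hyperedges, so the expected deficit decays at rate \<open>q k / 4\<close>.\<close>

lemma selected_connected:
  assumes H: "hypergraph V (mset es)"
    and k: "\<And>X. X \<subseteq> V \<Longrightarrow> X \<noteq> {} \<Longrightarrow> k \<le> card {t. t < length es \<and> crosses V X (es ! t)}"
    and ps: "length ps = length es" "\<And>p. p \<in> set ps \<Longrightarrow> 0 \<le> p \<and> p \<le> 1"
    and q: "0 \<le> q" "\<And>t. t < length es \<Longrightarrow> k div (2 * (card V)\<^sup>2) < min_pair_count (take (Suc t) es) \<Longrightarrow>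
      min_pair_count (take (Suc t) es) \<le> k \<Longrightarrow> q \<le> ps ! t"
    and rate: "ln (2 * card V) \<le> q * k / 4"
  shows "1 / 2 \<le> bernoulli_sum ps (\<lambda>b. of_bool (connected_spanning V (selected es b)))"
proof -
  have fin: "finite V" and V: "V \<noteq> {}" using H by (auto simp: hypergraph_def)
  hence n: "0 < card V" by (simp add: card_gt_0_iff)
  define g where "g b = real (deficit V (selected es b))" for b
  have hyp: "hypergraph V (selected es b)" for b
    using hypergraph_subset[OF H selected_subset] .
  have up: "selected es b \<subseteq># selected es (b[t := True])" for b t
    by (rule selected_mono, cases "t < length b") (auto simp: list_all2_conv_all_nth nth_list_update)
  have down: "selected es (b[t := False]) \<subseteq># selected es b" for b t
    by (rule selected_mono, cases "t < length b") (auto simp: list_all2_conv_all_nth nth_list_update)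
  define good where "good = {t. t < length es \<and> k div (2 * (card V)\<^sup>2) < min_pair_count (take (Suc t) es) \<and>
      min_pair_count (take (Suc t) es) \<le> k}"
  have good: "finite good" "good \<subseteq> {..<length es}" by (auto simp: good_def)
  have "bernoulli_sum ps g \<le> g (replicate (length ps) False) * exp (- (q * k / 4))"
  proof (rule bernoulli_sum_decay)
    show "g b \<le> g (b[t := False])" for b t
      using deficit_mono[OF hyp down] by (simp add: g_def)
  next
    fix b :: "bool list" assume b: "length b = length ps"
    let ?F = "selected es b"
    have drop0: "0 \<le> g b - g (b[t := True])" for t
      using deficit_mono[OF hyp up] by (simp add: g_def)
    show "q * k / 4 * g b \<le> (\<Sum>t<length ps. ps ! t * (g b - g (b[t := True])))"
    proof (cases "connected_spanning V ?F")
      case True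
      hence "g b = 0" by (simp add: g_def deficit_def)
      moreover have "0 \<le> (\<Sum>t<length ps. ps ! t * (g b - g (b[t := True])))"
        using drop0 ps(2) by (intro sum_nonneg mult_nonneg_nonneg) auto
      ultimately show ?thesis by simp
    next
      case False
      let ?C = "comps V ?F"
      have finC: "finite ?C" using fin by (rule finite_comps)
      have drop: "real (card {X \<in> ?C. crosses V X (es ! t)}) / 2 \<le> g b - g (b[t := True])" if "t < length es" for t
      proof -
        have "es ! t \<in># selected es (b[t := True])" using that b ps by (intro nth_in_selected) auto
        from deficit_add[OF hyp up this False] show ?thesis by (simp add: g_def field_simps flip: of_nat_add)
      qed
      have "q * k / 4 * g b = q / 2 * (\<Sum>X\<in>?C. k / 2)"
        using False by (simp add: g_def deficit_def)
      also have "\<dots> \<le> q / 2 * (\<Sum>X\<in>?C. real (card {t \<in> good. crosses V X (es ! t)}))"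
      proof (intro mult_left_mono sum_mono)
        fix X assume "X \<in> ?C"
        hence "X \<subseteq> V" "X \<noteq> {}"
          using in_quotient_imp_subset[OF equiv_vertex_rel] in_quotient_imp_non_empty[OF equiv_vertex_rel]
          unfolding comps_def by blast+
        from card_crossing_in_range[OF H this k[OF this]]
        have "k \<le> 2 * card {t \<in> good. crosses V X (es ! t)}"
          by (simp add: good_def conj_ac)
        thus "real k / 2 \<le> real (card {t \<in> good. crosses V X (es ! t)})" by linarith
      qed (use q in auto)
      also have "(\<Sum>X\<in>?C. real (card {t \<in> good. crosses V X (es ! t)}))
          = (\<Sum>t\<in>good. real (card {X \<in> ?C. crosses V X (es ! t)}))"
        using sum_multicount_gen[OF finC good(1), of "\<lambda>X t. crosses V X (es ! t)"
            "\<lambda>t. card {X \<in> ?C. crosses V X (es ! t)}"]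
        by (simp flip: of_nat_sum)
      also have "q / 2 * (\<Sum>t\<in>good. real (card {X \<in> ?C. crosses V X (es ! t)}))
          = (\<Sum>t\<in>good. q * (real (card {X \<in> ?C. crosses V X (es ! t)}) / 2))"
        by (simp add: sum_distrib_left)
      \<comment> \<open>A good hyperedge is selected with probability at least \<open>q\<close>, and
        adding it lowers the deficit by at least half the number of components it crosses.\<close>
      also have "\<dots> \<le> (\<Sum>t\<in>good. ps ! t * (g b - g (b[t := True])))"
        using drop q by (intro sum_mono mult_mono) (auto simp: good_def intro: order.trans)
      also have "\<dots> \<le> (\<Sum>t<length ps. ps ! t * (g b - g (b[t := True])))"
        using good ps drop0 by (intro sum_mono2) auto
      finally show ?thesis .
    qed
  qed (use ps in auto)
  also have "\<dots> \<le> real (card V) * (1 / (2 * card V))"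
  proof (intro mult_mono)
    have "exp (- (q * k / 4)) \<le> exp (- ln (2 * card V))" using rate by simp
    also have "\<dots> = 1 / (2 * card V)" using n by (simp add: exp_minus inverse_eq_divide)
    finally show "exp (- (q * k / 4)) \<le> 1 / (2 * card V)" .
  qed (use deficit_le[OF fin] in \<open>auto simp: g_def\<close>)
  also have "\<dots> = 1 / 2" using n by simp
  finally have "bernoulli_sum ps g \<le> 1 / 2" .
  \<comment> \<open>Markov's inequality: the deficit is at least \<open>1\<close> on failure, so
    \<open>1 - g b\<close> is at most the indicator of success.\<close>
  moreover have "bernoulli_sum ps (\<lambda>b. 1 - g b) \<le> bernoulli_sum ps (\<lambda>b. of_bool (connected_spanning V (selected es b)))"
    using ps(2) card_comps_pos[OF fin V] by (intro bernoulli_sum_mono) (auto simp: g_def deficit_def)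
  ultimately show ?thesis by (simp add: bernoulli_sum_diff bernoulli_sum_const)
qed

section \<open>Probability of a correct guess\<close>

lemma finite_color_pmf: "finite (set_pmf (color_pmf n b k))"
  by (auto simp: color_pmf_def)

text \<open>Keep only the guess \<open>R\<close> that hits the exponent \<open>i\<close>; given this
  guess, \<open>c\<close> is uniform among \<open>palette n i + 1\<close> colors.\<close>

lemma color_pmf_ge:
  assumes "R \<le> guess_range n" "floor_log k + R = i" "1 \<le> c" "c \<le> palette n i + 1"
  shows "1 / (real (guess_range n + 1) * real (palette n i + 1)) \<le> pmf (color_pmf n 0 k) c"
proof -
  let ?f = "\<lambda>R. pmf (map_pmf Suc (pmf_of_set {0..palette n (floor_log k + R)})) c"
  obtain x where x: "c = Suc x" using assms(3) by (cases c) auto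
  have "?f R = 1 / real (palette n i + 1)"
    using assms x by (simp add: pmf_map_inj' pmf_of_set)
  moreover have "?f R / real (guess_range n + 1) \<le> (\<Sum>R\<in>{0..guess_range n}. ?f R / real (guess_range n + 1))"
    using assms(1) by (intro member_le_sum) auto
  moreover have "pmf (color_pmf n 0 k) c = (\<Sum>R\<in>{0..guess_range n}. ?f R / real (guess_range n + 1))"
    by (simp add: color_pmf_def pmf_bind integral_pmf_of_set sum_divide_distrib)
  ultimately show ?thesis by (simp add: mult.commute)
qed


text \<open>Write \<open>L = floor_log n + 1\<close> and \<open>T = 2 ^ floor_log k\<close>. The
  hypothesis \<open>64 L^2 \<le> T\<close> absorbs the extra color, so there are at most
  \<open>T / (32 L^2)\<close> colors, and at most \<open>4 L\<close> guesses. The product is at most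
  \<open>T / (8 L)\<close>, and the rate is at least \<open>2 L\<close>, which exceeds
  \<open>ln (2 * n)\<close>.\<close>

lemma guess_rate:
  assumes n: "1 \<le> n" and k: "0 < k" "64 * (floor_log n + 1)\<^sup>2 \<le> 2 ^ floor_log k"
  shows "ln (2 * n) \<le> 1 / (real (guess_range n + 1) * real (palette n (floor_log k) + 1)) * k / 4"
proof -
  define L where "L = real (floor_log n + 1)"
  define P where "P = real (palette n (floor_log k) + 1)"
  define T :: real where "T = 2 ^ floor_log k"
  have L: "1 \<le> L" by (simp add: L_def)
  have T: "T \<le> real k" using floor_log_exp2_le[OF k(1)] by (simp add: T_def flip: of_nat_power_le_of_nat_cancel_iff)
  have T64: "64 * L\<^sup>2 \<le> T"
    using of_nat_mono[OF k(2), where 'a = real] by (simp add: L_def T_def)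
  have "real (palette n (floor_log k)) \<le> T / (64 * L\<^sup>2)"
    unfolding palette_def T_def L_def
    by (rule order.trans[OF of_nat_div_le_of_nat]) simp
  moreover have "1 \<le> T / (64 * L\<^sup>2)" using T64 L by (simp add: field_simps)
  ultimately have P: "P \<le> T / (32 * L\<^sup>2)" by (simp add: P_def field_simps)
  have P0: "0 < P" by (simp add: P_def)
  have G: "real (guess_range n + 1) \<le> 4 * L" by (simp add: guess_range_def L_def)
  have "real n \<le> 2 * 2 ^ floor_log n"
    using of_nat_mono[OF floor_log_exp2_ge[of n], where 'a = real] by simp
  hence "2 * real n \<le> 2 powr (L + 1)" by (simp add: L_def powr_add powr_realpow)
  hence "ln (2 * real n) \<le> ln (2 powr (L + 1))" using n by (subst ln_le_cancel_iff) auto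
  also have "\<dots> = (L + 1) * ln 2" by (simp add: ln_powr)
  also have "\<dots> \<le> (L + 1) * 1" using L ln_2_less_1 by (intro mult_left_mono) auto
  also have "\<dots> \<le> 2 * L" using L by simp
  also have "2 * L = 1 / (4 * L * (T / (32 * L\<^sup>2))) * T / 4"
    using L T64 by (simp add: field_simps power2_eq_square T_def)
  also have "\<dots> \<le> 1 / (real (guess_range n + 1) * P) * T / 4"
    using G P P0 L by (intro divide_right_mono mult_right_mono divide_left_mono mult_mono mult_pos_pos) (auto simp: T_def)
  also have "\<dots> \<le> 1 / (real (guess_range n + 1) * P) * k / 4"
    using T P0 by (intro divide_right_mono mult_left_mono) auto
  finally show ?thesis by (simp add: P_def)
qed

text \<open>Rounding \<open>n\<close> and \<open>m\<close> up to powers of two in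
  \<open>k < 2 n^2 m\<close> makes the exponents of \<open>k\<close> and \<open>m\<close> differ by
  less than \<open>2 * floor_log n + 4\<close>; the witness is this difference.\<close>

lemma guess_in_range:
  assumes "0 < n" "0 < k" "k div (2 * n\<^sup>2) < m" "m \<le> k"
  obtains R where "R \<le> guess_range n" "floor_log m + R = floor_log k"
proof -
  have le: "floor_log m \<le> floor_log k" using assms(4) by (rule floor_log_le_iff)
  have n2: "0 < 2 * n\<^sup>2" using assms(1) by simp
  have "2 ^ floor_log k \<le> k" using assms(2) by (rule floor_log_exp2_le)
  also have "k < 2 * n\<^sup>2 * m"
    using assms(3) n2 by (simp add: div_less_iff_less_mult mult.commute)
  also have "\<dots> \<le> 2 * (2 * 2 ^ floor_log n)\<^sup>2 * (2 * 2 ^ floor_log m)"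
    using floor_log_exp2_ge[of n] floor_log_exp2_ge[of m] by (intro mult_le_mono power_mono) auto
  also have "\<dots> = 2 ^ (4 + 2 * floor_log n + floor_log m)"
    by (simp add: power_add power_mult power2_eq_square power_mult_distrib flip: power_mult_distrib)
  finally have "floor_log k < 4 + 2 * floor_log n + floor_log m" by simp
  thus ?thesis using le that[of "floor_log k - floor_log m"] by (simp add: guess_range_def)
qed

lemma finite_connected_spanning_colors:
  assumes "V \<noteq> {}" shows "finite {c. connected_spanning V (color_class es cs c)}"
proof -
  have "c \<in> set cs" if "connected_spanning V (color_class es cs c)" for c
  proof -
    have "color_class es cs c \<noteq> {#}" using connected_spanning_nonempty[OF that assms] .
    thus ?thesis by (auto simp: color_class_def filter_empty_conv dest: set_zip_rightD)
  qed
  hence "{c. connected_spanning V (color_class es cs c)} \<subseteq> set cs" by blast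
  thus ?thesis by (rule finite_subset) simp
qed

lemma num_connected_spanning_colors_ge:
  assumes "V \<noteq> {}" "finite C"
  shows "(\<Sum>c\<in>C. of_bool (connected_spanning V (color_class es cs c)))
    \<le> real (num_connected_spanning_colors V es cs)"
proof -
  have "(\<Sum>c\<in>C. of_bool (connected_spanning V (color_class es cs c)) :: real)
      = real (card {c \<in> C. connected_spanning V (color_class es cs c)})"
    using assms(2) by (simp add: sum.If_cases of_bool_def Int_def)
  also have "\<dots> \<le> real (num_connected_spanning_colors V es cs)"
    unfolding num_connected_spanning_colors_def of_nat_le_iff
    using finite_connected_spanning_colors[OF assms(1)] by (intro card_mono) auto
  finally show ?thesis .
qed

text \<open>\<open>512 = 8 * 64\<close>: the \<open>64\<close> is that of \<open>palette\<close>,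
  and a factor \<open>2\<close> is lost to each of the coin, the success probability one half, and
  rounding \<open>k\<close> down to a power of two.\<close>

definition ratio :: "nat \<Rightarrow> real" where
  "ratio n = 512 * (real (floor_log n) + 1)\<^sup>2"

section \<open>Expected number of connected spanning colors\<close>

lemma expectation_output_pmf:
  fixes f :: "nat list \<Rightarrow> real"
  assumes "es = map set rs"
  shows "(\<integral>out. f (map fst out) \<partial>output_pmf n b [] rs) = (\<integral>cs. f cs \<partial>indep_pmf (color_pmfs n b [] es))"
proof -
  have "(\<integral>out. f (map fst out) \<partial>output_pmf n b [] rs)
      = (\<integral>cs. f (map fst (zip cs (map (step_cost b \<circ> length) rs))) \<partial>indep_pmf (color_pmfs n b [] es))"
    by (simp add: output_pmf_def assms)
  also have "\<dots> = (\<integral>cs. f cs \<partial>indep_pmf (color_pmfs n b [] es))"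
  proof (intro integral_cong_AE)
    show "AE cs in measure_pmf (indep_pmf (color_pmfs n b [] es)).
        f (map fst (zip cs (map (step_cost b \<circ> length) rs))) = f cs"
      by (rule AE_pmfI) (auto simp: set_indep_pmf color_pmfs_def assms dest: list_all2_lengthD)
  qed auto
  finally show ?thesis .
qed

lemma expected_colors_coin_1:
  assumes "connected_spanning V (mset es)" "V \<noteq> {}"
  shows "1 \<le> (\<integral>cs. real (num_connected_spanning_colors V es cs) \<partial>indep_pmf (color_pmfs n 1 [] es))"
proof -
  have const: "indep_pmf (map (\<lambda>_. return_pmf x) xs) = return_pmf (replicate (length xs) x)" for x :: nat and xs :: "nat list"
    by (induction xs) (auto simp: bind_return_pmf)
  have "color_class es (replicate (length es) 1) 1 = mset es"
    by (induction es) (auto simp: color_class_def)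
  hence "1 \<le> real (num_connected_spanning_colors V es (replicate (length es) 1))"
    using num_connected_spanning_colors_ge[of V "{1}" es "replicate (length es) 1"] assms by simp
  moreover have "color_pmfs n 1 [] es = map (\<lambda>_. return_pmf 1) [0..<length es]"
    by (simp add: color_pmfs_def color_pmf_def)
  ultimately show ?thesis by (simp add: const)
qed

text \<open>Each color of the palette for exponent \<open>floor_log k\<close> succeeds with
  probability at least one half. Linearity of expectation adds these up whatever the dependence
  between colors.\<close>

lemma expected_colors_coin_0:
  fixes n :: nat and es :: "nat set list"
  defines "k \<equiv> opt {..<n} (mset es)"
  assumes H: "hypergraph {..<n} (mset es)" and k: "0 < k" "64 * (floor_log n + 1)\<^sup>2 \<le> 2 ^ floor_log k"
  shows "real (palette n (floor_log k) + 1) / 2 \<le>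
    (\<integral>cs. real (num_connected_spanning_colors {..<n} es cs) \<partial>indep_pmf (color_pmfs n 0 [] es))"
proof -
  let ?V = "{..<n}" and ?D = "color_pmfs n 0 [] es" and ?K = "palette n (floor_log k) + 1"
  let ?f = "\<lambda>c b. of_bool (connected_spanning ?V (selected es b)) :: real"
  have n: "0 < n" using H by (auto simp: hypergraph_def)
  have fin: "finite (set_pmf D)" if "D \<in> set ?D" for D
    using that finite_color_pmf by (auto simp: color_pmfs_def)
  have finD: "finite (set_pmf (indep_pmf ?D))" using fin by (rule finite_set_indep_pmf)
  have half: "1 / 2 \<le> (\<integral>cs. (of_bool (connected_spanning ?V (color_class es cs c)) :: real) \<partial>indep_pmf ?D)"
    if c: "c \<in> {1..?K}" for c
  proof -
    have "1 / 2 \<le> bernoulli_sum (map (\<lambda>D. pmf D c) ?D) (\<lambda>b. of_bool (connected_spanning ?V (selected es b)))"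
    proof (rule selected_connected[OF H])
      show "k \<le> card {t. t < length es \<and> crosses ?V X (es ! t)}" if "X \<subseteq> ?V" "X \<noteq> {}" for X
        unfolding k_def using opt_le_crossing[OF H that] .
      show "ln (2 * card ?V) \<le> 1 / (real (guess_range n + 1) * real ?K) * k / 4"
        using guess_rate[of n k] n k by simp
    next
      \<comment> \<open>For an in-range minimum some allowed guess reaches exactly the exponent of
        \<open>k\<close>, so \<open>c\<close> is drawn from the intended palette often
        enough.\<close>
      fix t assume t: "t < length es" "k div (2 * (card ?V)\<^sup>2) < min_pair_count (take (Suc t) es)"
        "min_pair_count (take (Suc t) es) \<le> k"
      obtain R where "R \<le> guess_range n" "floor_log (min_pair_count (take (Suc t) es)) + R = floor_log k"
        using guess_in_range[OF n k(1) _ t(3)] t(2) by auto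
      from color_pmf_ge[OF this, of c]
      show "1 / (real (guess_range n + 1) * real ?K) \<le> map (\<lambda>D. pmf D c) ?D ! t"
        using c t(1) by (simp add: color_pmfs_def)
    qed (auto simp: color_pmfs_def pmf_le_1)
    also have "\<dots> = (\<integral>cs. of_bool (connected_spanning ?V (color_class es cs c)) \<partial>indep_pmf ?D)"
      unfolding color_class_eq_selected by (rule expectation_indep_pmf[OF fin, symmetric])
    finally show ?thesis .
  qed
  have "real ?K / 2 = (\<Sum>c\<in>{1..?K}. 1 / 2)" by simp
  also have "\<dots> \<le> (\<Sum>c\<in>{1..?K}. (\<integral>cs. of_bool (connected_spanning ?V (color_class es cs c)) \<partial>indep_pmf ?D))"
    using half by (rule sum_mono)
  also have "\<dots> = (\<integral>cs. (\<Sum>c\<in>{1..?K}. of_bool (connected_spanning ?V (color_class es cs c))) \<partial>indep_pmf ?D)"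
    by (intro Bochner_Integration.integral_sum[symmetric] integrable_measure_pmf_finite finD)
  also have "\<dots> \<le> (\<integral>cs. real (num_connected_spanning_colors ?V es cs) \<partial>indep_pmf ?D)"
    using n by (intro integral_mono integrable_measure_pmf_finite finD num_connected_spanning_colors_ge) auto
  finally show ?thesis .
qed

lemma arrival_sequenceD:
  assumes "arrival_sequence n es rs"
  shows "1 \<le> n" "es = map set rs" "\<forall>r\<in>set rs. distinct r \<and> r \<noteq> [] \<and> set r \<subseteq> {..<n}"
proof -
  have H: "hypergraph {..<n} (mset es)" and all: "list_all2 (\<lambda>e r. distinct r \<and> set r = e) es rs"
    using assms by (auto simp: arrival_sequence_def)
  show "1 \<le> n" using H by (cases n) (auto simp: hypergraph_def)
  show es: "es = map set rs" using all by (induction rule: list_all2_induct) auto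
  show "\<forall>r\<in>set rs. distinct r \<and> r \<noteq> [] \<and> set r \<subseteq> {..<n}"
    using H all es by (auto simp: hypergraph_def list_all2_conv_all_nth in_set_conv_nth)
qed

lemma expected_ratio:
  assumes "arrival_sequence n es rs"
  shows "real (opt {..<n} (mset es)) / ratio n \<le>
    (\<integral>out. real (num_connected_spanning_colors {..<n} es (map fst out)) \<partial>measure_spmf (run packing_algorithm n rs))"
proof -
  define k where "k = opt {..<n} (mset es)"
  define L where "L = real (floor_log n) + 1"
  define E where "E b = (\<integral>cs. real (num_connected_spanning_colors {..<n} es cs) \<partial>indep_pmf (color_pmfs n b [] es))" for b
  note arr = arrival_sequenceD[OF assms]
  have H: "hypergraph {..<n} (mset es)" using assms by (simp add: arrival_sequence_def)
  have L: "1 \<le> L" by (simp add: L_def)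
  have fin: "finite (set_pmf (output_pmf n b [] rs))" for b
    unfolding output_pmf_def set_map_pmf using finite_color_pmf
    by (intro finite_imageI finite_set_indep_pmf) (auto simp: color_pmfs_def)
  have "(\<integral>out. real (num_connected_spanning_colors {..<n} es (map fst out)) \<partial>measure_spmf (run packing_algorithm n rs))
      = (\<Sum>b\<in>{0..1}. E b / 2)"
    unfolding run_packing_algorithm[OF arr(1,3)] measure_spmf_spmf_of_pmf E_def
      expectation_output_pmf[OF arr(2), symmetric]
    using fin by (subst pmf_expectation_bind_pmf_of_set) (auto simp: field_simps)
  also have "\<dots> = E 0 / 2 + E 1 / 2" by simp
  finally have total: "(\<integral>out. real (num_connected_spanning_colors {..<n} es (map fst out)) \<partial>measure_spmf (run packing_algorithm n rs))
      = E 0 / 2 + E 1 / 2" .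
  have E0: "0 \<le> E b" for b by (simp add: E_def)
  have "real k / ratio n \<le> E 0 / 2 + E 1 / 2"
  proof (cases "k = 0")
    case True
    thus ?thesis using E0[of 0] E0[of 1] by simp
  next
    case False
    have k2: "real k \<le> 2 * 2 ^ floor_log k"
      using of_nat_mono[OF floor_log_exp2_ge[of k], where 'a = real] by simp
    have big: "64 * (floor_log n + 1)\<^sup>2 \<le> 2 ^ floor_log k \<longleftrightarrow> 64 * L\<^sup>2 \<le> 2 ^ floor_log k"
      using of_nat_le_iff[where 'a = real, of "64 * (floor_log n + 1)\<^sup>2" "2 ^ floor_log k"]
      by (simp add: L_def add.commute)
    show ?thesis
    \<comment> \<open>If the palette for \<open>k\<close> is large, coin \<open>0\<close> yields
      enough colors. Otherwise \<open>k\<close> is below \<open>128 * L\<^sup>2\<close>, and the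
      single color of coin \<open>1\<close> suffices.\<close>
    proof (cases "64 * (floor_log n + 1)\<^sup>2 \<le> 2 ^ floor_log k")
      case True
      have "2 ^ floor_log k / (64 * L\<^sup>2) = real (2 ^ floor_log k) / real (64 * (floor_log n + 1)\<^sup>2)"
        by (simp add: L_def add.commute)
      also have "\<dots> \<le> real (palette n (floor_log k) + 1)"
      proof -
        have "real a / real c \<le> real (a div c) + 1" for a c :: nat
          using floor_divide_of_nat_eq[of a c, where 'a = real] by linarith
        thus ?thesis unfolding palette_def of_nat_add of_nat_1 .
      qed
      finally have "2 ^ floor_log k / (64 * L\<^sup>2) \<le> 2 * E 0"
        using expected_colors_coin_0[OF H, folded k_def] True False by (simp add: E_def)
      moreover have "real k / ratio n \<le> 2 * 2 ^ floor_log k / ratio n"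
        using k2 by (intro divide_right_mono) (auto simp: ratio_def)
      hence "real k / ratio n \<le> 2 ^ floor_log k / (64 * L\<^sup>2) / 4"
        by (simp add: ratio_def L_def)
      moreover have "x \<le> 2 * y \<Longrightarrow> u \<le> x / 4 \<Longrightarrow> 0 \<le> v \<Longrightarrow> u \<le> y / 2 + v / 2" for x y u v :: real
        by linarith
      ultimately show ?thesis using E0[of 1] by blast
    next
      case small: False
      have "connected_spanning {..<n} (mset es)"
        using connected_spanning_if_opt_pos[OF H] False by (simp add: k_def)
      hence "1 \<le> E 1" unfolding E_def using arr(1) by (intro expected_colors_coin_1) (auto simp: lessThan_empty_iff)
      moreover have "real k \<le> ratio n / 2"
        using small big k2 unfolding ratio_def L_def by simp
      hence "real k / ratio n \<le> 1 / 2" using L by (simp add: ratio_def field_simps)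
      ultimately show ?thesis using E0[of 0] by linarith
    qed
  qed
  thus ?thesis using total by (simp add: k_def)
qed

text \<open>For \<open>n \<ge> 2\<close> one has \<open>floor_log n + 1 \<le> 2 * log 2 n\<close>;
  squaring gives \<open>2048 = 4 * 512\<close>.\<close>

lemma ratio_bigo: "ratio \<in> O(\<lambda>n. (log 2 (real n))\<^sup>2)"
proof (rule bigoI)
  show "\<forall>\<^sub>F n in at_top. norm (ratio n) \<le> 2048 * norm ((log 2 (real n))\<^sup>2)"
    using eventually_ge_at_top[of 2]
  proof eventually_elim
    case (elim n)
    have "1 \<le> log 2 (real n)" using elim by (simp add: le_log_iff)
    moreover have "real (floor_log n) \<le> log 2 (real n)"
      using elim calculation by (simp add: floor_log_altdef)
    ultimately have "real (floor_log n) + 1 \<le> 2 * log 2 (real n)" by simp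
    hence "(real (floor_log n) + 1)\<^sup>2 \<le> (2 * log 2 (real n))\<^sup>2" by (intro power_mono) auto
    thus ?case by (simp add: ratio_def power_mult_distrib)
  qed
qed

section \<open>Positivity of colors and running time\<close>

lemma output_in_run:
  assumes "arrival_sequence n es rs" "out \<in> set_spmf (run packing_algorithm n rs)"
  obtains b cs where "b \<le> 1" "length cs = length rs" "\<And>c. c \<in> set cs \<Longrightarrow> 0 < c"
    "out = zip cs (map (step_cost b \<circ> length) rs)"
proof -
  note arr = arrival_sequenceD[OF assms(1)]
  obtain b where b: "b \<le> 1" "out \<in> set_pmf (output_pmf n b [] rs)"
    using assms(2) unfolding run_packing_algorithm[OF arr(1,3)] by auto
  then obtain cs where cs: "cs \<in> set_pmf (indep_pmf (color_pmfs n b [] es))"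
    "out = zip cs (map (step_cost b \<circ> length) rs)"
    by (auto simp: output_pmf_def arr(2))
  have all: "list_all2 (\<lambda>c D. c \<in> set_pmf D) cs (color_pmfs n b [] es)"
    using cs(1) by (simp add: set_indep_pmf)
  have "0 < c" if c: "c \<in> set cs" for c
  proof -
    obtain i where "i < length cs" "c = cs ! i" using c by (auto simp: in_set_conv_nth)
    hence "c \<in> set_pmf (color_pmf n b (min_pair_count (take (Suc i) es)))"
      using all by (auto simp: list_all2_conv_all_nth color_pmfs_def)
    thus ?thesis by (auto simp: color_pmf_def split: if_splits)
  qed
  thus ?thesis using that[OF b(1) _ _ cs(2)] all by (auto simp: color_pmfs_def arr(2) dest: list_all2_lengthD)
qed

text \<open>\<open>137 = 26 + 71 + 40\<close>; hyperedges are nonempty, so the squared size absorbs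
  the constant terms.\<close>

lemma cost_in_run:
  assumes "arrival_sequence n es rs" "out \<in> set_spmf (run packing_algorithm n rs)" "t < length es"
  shows "snd (out ! t) \<le> 137 * (card (es ! t))\<^sup>2"
proof -
  note arr = arrival_sequenceD[OF assms(1)]
  obtain b cs where cs: "b \<le> 1" "length cs = length rs" "out = zip cs (map (step_cost b \<circ> length) rs)"
    using output_in_run[OF assms(1,2)] by blast
  have t: "t < length rs" using assms(3) arr(2) by simp
  have r: "distinct (rs ! t)" "rs ! t \<noteq> []" using arr(3) t by auto
  have "snd (out ! t) = step_cost b (length (rs ! t))" using cs t by simp
  also have "length (rs ! t) = card (es ! t)" using r t arr(2) by (simp add: distinct_card)
  also have "step_cost b (card (es ! t)) \<le> 137 * (card (es ! t))\<^sup>2"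
  proof -
    have "0 < card (es ! t)" using r t arr(2) by (simp add: card_gt_0_iff)
    hence "1 \<le> (card (es ! t))\<^sup>2" by simp
    thus ?thesis unfolding step_cost_def by (cases "b = 0") simp_all
  qed
  finally show ?thesis .
qed

theorem theorem1p2:
  shows "\<exists>(A :: online_algorithm) (\<alpha> :: nat \<Rightarrow> real).
    valid_online_algorithm A \<and>
    (\<forall>n. \<alpha> n > 0) \<and>
    \<alpha> \<in> O(\<lambda>n. (log 2 (real n))\<^sup>2) \<and>
    expected_competitive_ratio A \<alpha> \<and>
    (\<exists>C. timestep_cost_le A (\<lambda>e. True) (\<lambda>e. C * (card e)\<^sup>2)) \<and>
    (\<exists>C. timestep_cost_le A (\<lambda>e. card e = 2) (\<lambda>e. C))"
proof (intro exI conjI)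
  show "valid_online_algorithm packing_algorithm"
    unfolding valid_online_algorithm_def
  proof (intro allI impI conjI ballI)
    fix n es rs assume arr: "arrival_sequence n es rs"
    show "lossless_spmf (run packing_algorithm n rs)"
      unfolding run_packing_algorithm[OF arrival_sequenceD(1,3)[OF arr]] by simp
    fix out x assume "out \<in> set_spmf (run packing_algorithm n rs)" "x \<in> set out"
    thus "case x of (c, s) \<Rightarrow> 0 < c"
      by (elim output_in_run[OF arr]) (auto dest: set_zip_leftD)
  qed
  show "\<forall>n. 0 < ratio n" by (auto simp: ratio_def intro!: add_nonneg_pos)
  show "ratio \<in> O(\<lambda>n. (log 2 (real n))\<^sup>2)" by (rule ratio_bigo)
  show "expected_competitive_ratio packing_algorithm ratio"
    using expected_ratio by (simp add: expected_competitive_ratio_def)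
  show "timestep_cost_le packing_algorithm (\<lambda>e. True) (\<lambda>e. 137 * (card e)\<^sup>2)"
    using cost_in_run by (simp add: timestep_cost_le_def)
  show "timestep_cost_le packing_algorithm (\<lambda>e. card e = 2) (\<lambda>e. 137 * 2\<^sup>2)"
    unfolding timestep_cost_le_def using cost_in_run by (metis nth_mem)
qed

end
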